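(* Let $R$ be a unital associative ring, $W$ a right $R$-module, and let $\phi$ be an elementary extension of $e_*(\mathsf I)$ by $\mathsf I(W)$ in $\mathcal B(R,\mathbb Z)$, represented by a quasiexact sequence $$0\to \mathsf I(W)[1]\to C_\bullet\to e_*(\mathsf I)\to 0$$ of complexes in $\mathcal B(R,\mathbb Z)$. Then $\phi$ admits a splitting $C_{01}$, and this splitting is unique up to an isomorphism.
   Context: Let $R\text{-proj}$ be the category of finitely generated projective left $R$-modules, and $\mathcal B(R,\mathbb Z)$ the abelian category of pointed functors ($F(0)=0$, not necessarily additive) from $R\text{-proj}$ to abelian groups. $e_*(\mathsf I)\in\mathcal B(R,\mathbb Z)$ is the forgetful functor sending $V$ to its underlying abelian group; for a right $R$-module $W$, $\mathsf I(W)\in\mathcal B(R,\mathbb Z)$ is $V\mapsto W\otimes_RV$. Complexes are homologically graded, $E[m]_n=E_{n-m}$. A sequence of complexes $0\to B_\bullet\xrightarrow{b}E_\bullet\xrightarrow{a}A_\bullet\to 0$ (with $ab=0$) in an abelian category is quasiexact if $b$ is injective, $a$ is surjective and $\operatorname{Ker}a/\operatorname{Im}b$ is acyclic. An elementary extension of an object $A$ by an object $B$ is a quasiexact sequence $0\to B[1]\xrightarrow{b}C_\bullet\xrightarrow{a}A\to0$ with $C_\bullet$ concentrated in degrees $0,1$ (equivalently an exact sequence $0\to B\xrightarrow{b} C_1\xrightarrow{d}C_0\xrightarrow{a}A\to 0$). A splitting of it is an object $C_{01}$ with maps $c_1:C_1\to C_{01}$ and $c_0:C_{01}\to C_0$ such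 that $c_1$ is injective, $c_0$ is surjective, $c_0c_1=d$ and $\operatorname{Ker}c_0=c_1(b(B))$; morphisms of splittings are maps compatible with $c_0,c_1$. *)

theory Defs
  imports "HOL-Algebra.Module" "HOL-Algebra.Generated_Groups" "HOL-Algebra.Elementary_Groups"
    "HOL-Algebra.Free_Abelian_Groups"
begin

section \<open>Modules over a not necessarily commutative ring\<close>

text \<open>The library locale \<^locale>\<open>module\<close> is restricted to commutative rings, so only its record type
  is used here.  The fields \<open>mult\<close> and \<open>one\<close> which that record inherits from \<open>ring\<close> carry no
  meaning for modules.\<close>

locale left_module = R?: ring R + M?: abelian_group M
  for R (structure) and M :: "('r, 'v) module" (structure) +
  assumes smult_closed: "\<lbrakk>r \<in> carrier R; x \<in> carrier M\<rbrakk> \<Longrightarrow> r \<odot>\<^bsub>M\<^esub> x \<in> carrier M"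
    and smult_l_distr: "\<lbrakk>r \<in> carrier R; s \<in> carrier R; x \<in> carrier M\<rbrakk> \<Longrightarrow>
      (r \<oplus>\<^bsub>R\<^esub> s) \<odot>\<^bsub>M\<^esub> x = r \<odot>\<^bsub>M\<^esub> x \<oplus>\<^bsub>M\<^esub> s \<odot>\<^bsub>M\<^esub> x"
    and smult_r_distr: "\<lbrakk>r \<in> carrier R; x \<in> carrier M; y \<in> carrier M\<rbrakk> \<Longrightarrow>
      r \<odot>\<^bsub>M\<^esub> (x \<oplus>\<^bsub>M\<^esub> y) = r \<odot>\<^bsub>M\<^esub> x \<oplus>\<^bsub>M\<^esub> r \<odot>\<^bsub>M\<^esub> y"
    and smult_assoc: "\<lbrakk>r \<in> carrier R; s \<in> carrier R; x \<in> carrier M\<rbrakk> \<Longrightarrow>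
      (r \<otimes>\<^bsub>R\<^esub> s) \<odot>\<^bsub>M\<^esub> x = r \<odot>\<^bsub>M\<^esub> (s \<odot>\<^bsub>M\<^esub> x)"
    and smult_one: "x \<in> carrier M \<Longrightarrow> \<one>\<^bsub>R\<^esub> \<odot>\<^bsub>M\<^esub> x = x"

text \<open>For a right module \<open>W\<close> the term \<open>r \<odot>\<^bsub>W\<^esub> w\<close> stands for \<open>w\<cdot>r\<close>.\<close>

locale right_module = R?: ring R + W?: abelian_group W
  for R (structure) and W :: "('r, 'w) module" (structure) +
  assumes smult_closed: "\<lbrakk>r \<in> carrier R; x \<in> carrier W\<rbrakk> \<Longrightarrow> r \<odot>\<^bsub>W\<^esub> x \<in> carrier W"
    and smult_l_distr: "\<lbrakk>r \<in> carrier R; s \<in> carrier R; x \<in> carrier W\<rbrakk> \<Longrightarrow>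
      (r \<oplus>\<^bsub>R\<^esub> s) \<odot>\<^bsub>W\<^esub> x = r \<odot>\<^bsub>W\<^esub> x \<oplus>\<^bsub>W\<^esub> s \<odot>\<^bsub>W\<^esub> x"
    and smult_r_distr: "\<lbrakk>r \<in> carrier R; x \<in> carrier W; y \<in> carrier W\<rbrakk> \<Longrightarrow>
      r \<odot>\<^bsub>W\<^esub> (x \<oplus>\<^bsub>W\<^esub> y) = r \<odot>\<^bsub>W\<^esub> x \<oplus>\<^bsub>W\<^esub> r \<odot>\<^bsub>W\<^esub> y"
    and smult_assoc: "\<lbrakk>r \<in> carrier R; s \<in> carrier R; x \<in> carrier W\<rbrakk> \<Longrightarrow>
      (r \<otimes>\<^bsub>R\<^esub> s) \<odot>\<^bsub>W\<^esub> x = s \<odot>\<^bsub>W\<^esub> (r \<odot>\<^bsub>W\<^esub> x)"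
    and smult_one: "x \<in> carrier W \<Longrightarrow> \<one>\<^bsub>R\<^esub> \<odot>\<^bsub>W\<^esub> x = x"

text \<open>Linear maps are taken extensional, so that equality of morphisms of \<open>R\<close>-proj is equality
  in HOL.\<close>

definition linear_maps ::
    "('r, 'k) ring_scheme \<Rightarrow> ('r, 'v) module \<Rightarrow> ('r, 'u) module \<Rightarrow> ('v \<Rightarrow> 'u) set" where
  "linear_maps R M N = {f \<in> carrier M \<rightarrow>\<^sub>E carrier N.
     (\<forall>x\<in>carrier M. \<forall>y\<in>carrier M. f (x \<oplus>\<^bsub>M\<^esub> y) = f x \<oplus>\<^bsub>N\<^esub> f y) \<and>
     (\<forall>r\<in>carrier R. \<forall>x\<in>carrier M. f (r \<odot>\<^bsub>M\<^esub> x) = r \<odot>\<^bsub>N\<^esub> f x)}"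

definition finitely_generated :: "('r, 'k) ring_scheme \<Rightarrow> ('r, 'v) module \<Rightarrow> bool" where
  "finitely_generated R M \<longleftrightarrow> (\<exists>S. finite S \<and> S \<subseteq> carrier M \<and>
     (\<forall>x\<in>carrier M. \<exists>c \<in> S \<rightarrow> carrier R. x = (\<Oplus>\<^bsub>M\<^esub>s\<in>S. c s \<odot>\<^bsub>M\<^esub> s)))"

text \<open>The type \<open>'v\<close> is the universe of sets in which all left modules live; the lifting property
  is tested on modules of that universe.  If \<open>'r list\<close> embeds into \<open>'v\<close>, every finitely generated
  free module has a copy in \<open>'v\<close>; for finitely generated \<open>P\<close> the test against a surjection from
  such a copy onto \<open>P\<close> already makes \<open>P\<close> a direct summand of a free module.\<close>

definition projective :: "('r, 'k) ring_scheme \<Rightarrow> ('r, 'v) module \<Rightarrow> bool" where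
  "projective R P \<longleftrightarrow> (\<forall>(M :: ('r, 'v) module) (N :: ('r, 'v) module) g f.
     left_module R M \<longrightarrow> left_module R N \<longrightarrow>
     g \<in> linear_maps R M N \<longrightarrow> g ` carrier M = carrier N \<longrightarrow> f \<in> linear_maps R P N \<longrightarrow>
     (\<exists>h \<in> linear_maps R P M. \<forall>x\<in>carrier P. g (h x) = f x))"

definition proj_modules :: "('r, 'k) ring_scheme \<Rightarrow> ('r, 'v) module set" where
  "proj_modules R = {V. left_module R V \<and> finitely_generated R V \<and> projective R V}"


section \<open>Pointed functors from finitely generated projective modules to abelian groups\<close>

text \<open>Abelian groups are multiplicatively written \<^const>\<open>comm_group\<close>s.  \<open>fobj F V\<close> and \<open>fmap F V V' f\<close>
  are the values of \<open>F\<close> on an object \<open>V\<close> and on \<open>f : V \<rightarrow> V'\<close>; the type \<open>'c\<close> is the universe of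
  the values.  Group homomorphisms matter only up to equality on carriers, and functors with values
  in different types can be related by natural transformations.\<close>

record ('r, 'v, 'c) ab_functor =
  fobj :: "('r, 'v) module \<Rightarrow> 'c monoid"
  fmap :: "('r, 'v) module \<Rightarrow> ('r, 'v) module \<Rightarrow> ('v \<Rightarrow> 'v) \<Rightarrow> 'c \<Rightarrow> 'c"

type_synonym ('r, 'v, 'c, 'd) transformation = "('r, 'v) module \<Rightarrow> 'c \<Rightarrow> 'd"

definition pointed_functor :: "('r, 'k) ring_scheme \<Rightarrow> ('r, 'v, 'c) ab_functor \<Rightarrow> bool" where
  "pointed_functor R F \<longleftrightarrow>
     (\<forall>V\<in>proj_modules R. comm_group (fobj F V)) \<and>
     (\<forall>V\<in>proj_modules R. \<forall>V'\<in>proj_modules R. \<forall>f\<in>linear_maps R V V'.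
        fmap F V V' f \<in> hom (fobj F V) (fobj F V')) \<and>
     (\<forall>V\<in>proj_modules R. \<forall>x\<in>carrier (fobj F V). fmap F V V (\<lambda>v\<in>carrier V. v) x = x) \<and>
     (\<forall>V\<in>proj_modules R. \<forall>V'\<in>proj_modules R. \<forall>V''\<in>proj_modules R.
        \<forall>f\<in>linear_maps R V V'. \<forall>g\<in>linear_maps R V' V''. \<forall>x\<in>carrier (fobj F V).
          fmap F V V'' (compose (carrier V) g f) x = fmap F V' V'' g (fmap F V V' f x)) \<and>
     (\<forall>V\<in>proj_modules R. carrier V = {\<zero>\<^bsub>V\<^esub>} \<longrightarrow> carrier (fobj F V) = {\<one>\<^bsub>fobj F V\<^esub>})"

definition natural_transformation ::
    "('r, 'k) ring_scheme \<Rightarrow> ('r, 'v, 'c) ab_functor \<Rightarrow> ('r, 'v, 'd) ab_functor \<Rightarrow>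
     ('r, 'v, 'c, 'd) transformation \<Rightarrow> bool" where
  "natural_transformation R F G \<eta> \<longleftrightarrow>
     (\<forall>V\<in>proj_modules R. \<eta> V \<in> hom (fobj F V) (fobj G V)) \<and>
     (\<forall>V\<in>proj_modules R. \<forall>V'\<in>proj_modules R. \<forall>f\<in>linear_maps R V V'. \<forall>x\<in>carrier (fobj F V).
        \<eta> V' (fmap F V V' f x) = fmap G V V' f (\<eta> V x))"

text \<open>In the functor category, monomorphisms, epimorphisms, kernels, images and quotients are
  computed at each object separately.\<close>

definition injective_nat ::
    "('r, 'k) ring_scheme \<Rightarrow> ('r, 'v, 'c) ab_functor \<Rightarrow> ('r, 'v, 'c, 'd) transformation \<Rightarrow> bool" where
  "injective_nat R F \<eta> \<longleftrightarrow> (\<forall>V\<in>proj_modules R. inj_on (\<eta> V) (carrier (fobj F V)))"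

definition surjective_nat ::
    "('r, 'k) ring_scheme \<Rightarrow> ('r, 'v, 'c) ab_functor \<Rightarrow> ('r, 'v, 'd) ab_functor \<Rightarrow>
     ('r, 'v, 'c, 'd) transformation \<Rightarrow> bool" where
  "surjective_nat R F G \<eta> \<longleftrightarrow> (\<forall>V\<in>proj_modules R. \<eta> V ` carrier (fobj F V) = carrier (fobj G V))"

definition zero_functor :: "('r, 'v, 'c) ab_functor" where
  "zero_functor = \<lparr>fobj = (\<lambda>V. singleton_group undefined), fmap = (\<lambda>V V' f x. undefined)\<rparr>"

definition zero_on :: "('r, 'k) ring_scheme \<Rightarrow> ('r, 'v, 'c) ab_functor \<Rightarrow> bool" where
  "zero_on R F \<longleftrightarrow> (\<forall>V\<in>proj_modules R. carrier (fobj F V) = {\<one>\<^bsub>fobj F V\<^esub>})"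


section \<open>The functors \<open>e\<^sub>*(I)\<close> and \<open>I(W)\<close>\<close>

definition forgetful_functor :: "('r, 'v, 'v) ab_functor" where
  "forgetful_functor =
     \<lparr>fobj = (\<lambda>V. \<lparr>carrier = carrier V, monoid.mult = (\<oplus>\<^bsub>V\<^esub>), one = \<zero>\<^bsub>V\<^esub>\<rparr>), fmap = (\<lambda>V V' f. f)\<rparr>"

text \<open>\<open>W \<otimes>\<^sub>R V\<close> is the quotient of the free abelian group on the pairs \<open>(w, v)\<close> by the
  subgroup generated by the usual relations, the last one being \<open>(w\<cdot>r, v) = (w, r\<cdot>v)\<close>.\<close>

definition tensor_relations ::
    "('r, 'k) ring_scheme \<Rightarrow> ('r, 'w) module \<Rightarrow> ('r, 'v) module \<Rightarrow> ('w \<times> 'v \<Rightarrow>\<^sub>0 int) set" where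
  "tensor_relations R W V = generate (free_Abelian_group (carrier W \<times> carrier V))
     ({frag_of (w \<oplus>\<^bsub>W\<^esub> w', v) - frag_of (w, v) - frag_of (w', v) | w w' v.
         w \<in> carrier W \<and> w' \<in> carrier W \<and> v \<in> carrier V} \<union>
      {frag_of (w, v \<oplus>\<^bsub>V\<^esub> v') - frag_of (w, v) - frag_of (w, v') | w v v'.
         w \<in> carrier W \<and> v \<in> carrier V \<and> v' \<in> carrier V} \<union>
      {frag_of (r \<odot>\<^bsub>W\<^esub> w, v) - frag_of (w, r \<odot>\<^bsub>V\<^esub> v) | r w v.
         r \<in> carrier R \<and> w \<in> carrier W \<and> v \<in> carrier V})"

definition tensor_functor ::
    "('r, 'k) ring_scheme \<Rightarrow> ('r, 'w) module \<Rightarrow> ('r, 'v, ('w \<times> 'v \<Rightarrow>\<^sub>0 int) set) ab_functor" where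
  "tensor_functor R W =
     \<lparr>fobj = (\<lambda>V. free_Abelian_group (carrier W \<times> carrier V) Mod tensor_relations R W V),
      fmap = (\<lambda>V V' f X. tensor_relations R W V' <#>\<^bsub>free_Abelian_group (carrier W \<times> carrier V')\<^esub>
                frag_extend (\<lambda>(w, v). frag_of (w, f v)) ` X)\<rparr>"


section \<open>Complexes and elementary extensions\<close>

text \<open>\<open>cdiff E n\<close> is the differential \<open>E\<^sub>n \<rightarrow> E\<^bsub>n-1\<^esub>\<close>.\<close>

record ('r, 'v, 'c) ab_complex =
  cobj :: "int \<Rightarrow> ('r, 'v, 'c) ab_functor"
  cdiff :: "int \<Rightarrow> ('r, 'v, 'c, 'c) transformation"

definition chain_complex :: "('r, 'k) ring_scheme \<Rightarrow> ('r, 'v, 'c) ab_complex \<Rightarrow> bool" where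
  "chain_complex R E \<longleftrightarrow>
     (\<forall>n. pointed_functor R (cobj E n)) \<and>
     (\<forall>n. natural_transformation R (cobj E n) (cobj E (n - 1)) (cdiff E n)) \<and>
     (\<forall>n. \<forall>V\<in>proj_modules R. \<forall>x\<in>carrier (fobj (cobj E n) V).
        cdiff E (n - 1) V (cdiff E n V x) = \<one>\<^bsub>fobj (cobj E (n - 2)) V\<^esub>)"

definition chain_map ::
    "('r, 'k) ring_scheme \<Rightarrow> ('r, 'v, 'c) ab_complex \<Rightarrow> ('r, 'v, 'd) ab_complex \<Rightarrow>
     (int \<Rightarrow> ('r, 'v, 'c, 'd) transformation) \<Rightarrow> bool" where
  "chain_map R E E' f \<longleftrightarrow>
     (\<forall>n. natural_transformation R (cobj E n) (cobj E' n) (f n)) \<and>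
     (\<forall>n. \<forall>V\<in>proj_modules R. \<forall>x\<in>carrier (fobj (cobj E n) V).
        f (n - 1) V (cdiff E n V x) = cdiff E' n V (f n V x))"

definition single :: "('r, 'v, 'c) ab_functor \<Rightarrow> ('r, 'v, 'c) ab_complex" where
  "single F =
     \<lparr>cobj = (\<lambda>n. if n = 0 then F else zero_functor),
      cdiff = (\<lambda>n V x. \<one>\<^bsub>fobj (if n = 1 then F else zero_functor) V\<^esub>)\<rparr>"

text \<open>The shift \<open>E[m]\<close>, with \<open>E[m]\<^sub>n = E\<^bsub>n-m\<^esub>\<close> and the standard sign \<open>(-1)\<^sup>m\<close> on the differential.\<close>

definition shift :: "('r, 'v, 'c) ab_complex \<Rightarrow> int \<Rightarrow> ('r, 'v, 'c) ab_complex" where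
  "shift E m =
     \<lparr>cobj = (\<lambda>n. cobj E (n - m)),
      cdiff = (\<lambda>n V x. if even m then cdiff E (n - m) V x
                       else inv\<^bsub>fobj (cobj E (n - m - 1)) V\<^esub> (cdiff E (n - m) V x))\<rparr>"

text \<open>The complex \<open>Ker a / Im b\<close> for \<open>B \<rightarrow>\<^sup>b E \<rightarrow>\<^sup>a A\<close>; its values are groups of cosets of the
  image of \<open>b\<close> in the kernel of \<open>a\<close>, with the maps induced by those of \<open>E\<close>.\<close>

definition ker_mod_im ::
    "('r, 'v, 'b) ab_complex \<Rightarrow> ('r, 'v, 'c) ab_complex \<Rightarrow> ('r, 'v, 'a) ab_complex \<Rightarrow>
     (int \<Rightarrow> ('r, 'v, 'b, 'c) transformation) \<Rightarrow> (int \<Rightarrow> ('r, 'v, 'c, 'a) transformation) \<Rightarrow>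
     ('r, 'v, 'c set) ab_complex" where
  "ker_mod_im B E A b a =
     (let im = (\<lambda>n V. b n V ` carrier (fobj (cobj B n) V)) in
      \<lparr>cobj = (\<lambda>n.
         \<lparr>fobj = (\<lambda>V. (fobj (cobj E n) V)
             \<lparr>carrier := kernel (fobj (cobj E n) V) (fobj (cobj A n) V) (a n V)\<rparr> Mod im n V),
          fmap = (\<lambda>V V' f X. im n V' <#>\<^bsub>fobj (cobj E n) V'\<^esub> fmap (cobj E n) V V' f ` X)\<rparr>),
       cdiff = (\<lambda>n V X. im (n - 1) V <#>\<^bsub>fobj (cobj E (n - 1)) V\<^esub> cdiff E n V ` X)\<rparr>)"

definition acyclic_complex :: "('r, 'k) ring_scheme \<Rightarrow> ('r, 'v, 'c) ab_complex \<Rightarrow> bool" where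
  "acyclic_complex R E \<longleftrightarrow> (\<forall>n. \<forall>V\<in>proj_modules R.
     kernel (fobj (cobj E n) V) (fobj (cobj E (n - 1)) V) (cdiff E n V) =
     cdiff E (n + 1) V ` carrier (fobj (cobj E (n + 1)) V))"

definition quasiexact ::
    "('r, 'k) ring_scheme \<Rightarrow> ('r, 'v, 'b) ab_complex \<Rightarrow> ('r, 'v, 'c) ab_complex \<Rightarrow> ('r, 'v, 'a) ab_complex \<Rightarrow>
     (int \<Rightarrow> ('r, 'v, 'b, 'c) transformation) \<Rightarrow> (int \<Rightarrow> ('r, 'v, 'c, 'a) transformation) \<Rightarrow> bool" where
  "quasiexact R B E A b a \<longleftrightarrow>
     chain_complex R B \<and> chain_complex R E \<and> chain_complex R A \<and>
     chain_map R B E b \<and> chain_map R E A a \<and>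
     (\<forall>n. \<forall>V\<in>proj_modules R. \<forall>x\<in>carrier (fobj (cobj B n) V).
        a n V (b n V x) = \<one>\<^bsub>fobj (cobj A n) V\<^esub>) \<and>
     (\<forall>n. injective_nat R (cobj B n) (b n)) \<and>
     (\<forall>n. surjective_nat R (cobj E n) (cobj A n) (a n)) \<and>
     acyclic_complex R (ker_mod_im B E A b a)"

text \<open>The first functor is the extended one: this is an elementary extension of \<open>A\<close> by \<open>B\<close>.\<close>

definition elementary_extension ::
    "('r, 'k) ring_scheme \<Rightarrow> ('r, 'v, 'a) ab_functor \<Rightarrow> ('r, 'v, 'b) ab_functor \<Rightarrow>
     ('r, 'v, 'c) ab_complex \<Rightarrow>
     (int \<Rightarrow> ('r, 'v, 'b, 'c) transformation) \<Rightarrow> (int \<Rightarrow> ('r, 'v, 'c, 'a) transformation) \<Rightarrow> bool" where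
  "elementary_extension R A B C b a \<longleftrightarrow>
     quasiexact R (shift (single B) 1) C (single A) b a \<and>
     (\<forall>n. n \<noteq> 0 \<and> n \<noteq> 1 \<longrightarrow> zero_on R (cobj C n))"


section \<open>Splittings\<close>

definition splitting ::
    "('r, 'k) ring_scheme \<Rightarrow> ('r, 'v, 'b) ab_functor \<Rightarrow> ('r, 'v, 'c) ab_complex \<Rightarrow>
     (int \<Rightarrow> ('r, 'v, 'b, 'c) transformation) \<Rightarrow>
     ('r, 'v, 's) ab_functor \<Rightarrow> ('r, 'v, 'c, 's) transformation \<Rightarrow> ('r, 'v, 's, 'c) transformation \<Rightarrow>
     bool" where
  "splitting R B C b C\<^sub>0\<^sub>1 c\<^sub>1 c\<^sub>0 \<longleftrightarrow>
     pointed_functor R C\<^sub>0\<^sub>1 \<and>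
     natural_transformation R (cobj C 1) C\<^sub>0\<^sub>1 c\<^sub>1 \<and>
     natural_transformation R C\<^sub>0\<^sub>1 (cobj C 0) c\<^sub>0 \<and>
     injective_nat R (cobj C 1) c\<^sub>1 \<and>
     surjective_nat R C\<^sub>0\<^sub>1 (cobj C 0) c\<^sub>0 \<and>
     (\<forall>V\<in>proj_modules R. \<forall>x\<in>carrier (fobj (cobj C 1) V). c\<^sub>0 V (c\<^sub>1 V x) = cdiff C 1 V x) \<and>
     (\<forall>V\<in>proj_modules R. kernel (fobj C\<^sub>0\<^sub>1 V) (fobj (cobj C 0) V) (c\<^sub>0 V) =
        c\<^sub>1 V ` b 1 V ` carrier (fobj B V))"

definition splitting_map ::
    "('r, 'k) ring_scheme \<Rightarrow> ('r, 'v, 'c) ab_complex \<Rightarrow>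
     ('r, 'v, 's) ab_functor \<Rightarrow> ('r, 'v, 'c, 's) transformation \<Rightarrow> ('r, 'v, 's, 'c) transformation \<Rightarrow>
     ('r, 'v, 't) ab_functor \<Rightarrow> ('r, 'v, 'c, 't) transformation \<Rightarrow> ('r, 'v, 't, 'c) transformation \<Rightarrow>
     ('r, 'v, 's, 't) transformation \<Rightarrow> bool" where
  "splitting_map R C S s\<^sub>1 s\<^sub>0 T t\<^sub>1 t\<^sub>0 \<theta> \<longleftrightarrow>
     natural_transformation R S T \<theta> \<and>
     (\<forall>V\<in>proj_modules R. \<forall>x\<in>carrier (fobj (cobj C 1) V). \<theta> V (s\<^sub>1 V x) = t\<^sub>1 V x) \<and>
     (\<forall>V\<in>proj_modules R. \<forall>x\<in>carrier (fobj S V). t\<^sub>0 V (\<theta> V x) = s\<^sub>0 V x)"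

definition isomorphic_splittings ::
    "('r, 'k) ring_scheme \<Rightarrow> ('r, 'v, 'c) ab_complex \<Rightarrow>
     ('r, 'v, 's) ab_functor \<Rightarrow> ('r, 'v, 'c, 's) transformation \<Rightarrow> ('r, 'v, 's, 'c) transformation \<Rightarrow>
     ('r, 'v, 't) ab_functor \<Rightarrow> ('r, 'v, 'c, 't) transformation \<Rightarrow> ('r, 'v, 't, 'c) transformation \<Rightarrow>
     bool" where
  "isomorphic_splittings R C S s\<^sub>1 s\<^sub>0 T t\<^sub>1 t\<^sub>0 \<longleftrightarrow>
     (\<exists>\<theta> \<theta>'. splitting_map R C S s\<^sub>1 s\<^sub>0 T t\<^sub>1 t\<^sub>0 \<theta> \<and> splitting_map R C T t\<^sub>1 t\<^sub>0 S s\<^sub>1 s\<^sub>0 \<theta>' \<and>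
        (\<forall>V\<in>proj_modules R. \<forall>x\<in>carrier (fobj S V). \<theta>' V (\<theta> V x) = x) \<and>
        (\<forall>V\<in>proj_modules R. \<forall>y\<in>carrier (fobj T V). \<theta> V (\<theta>' V y) = y))"

end

theory Submission
  imports Defs
begin

text \<open>
  Write \<open>A\<close> for the forgetful functor and \<open>B\<close> for \<open>W \<otimes>\<^sub>R _\<close>.  An elementary extension amounts to an
  exact sequence \<open>0 \<rightarrow> B \<rightarrow> C\<^sub>1 \<rightarrow> C\<^sub>0 \<rightarrow> A \<rightarrow> 0\<close>, with maps \<open>b\<close>, \<open>d\<close>, \<open>a\<close>.  A splitting is the same as
  an extension of \<open>A\<close> by \<open>C\<^sub>1\<close> that induces \<open>C\<^sub>0\<close> modulo \<open>B\<close>, and such an extension is constructed,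
  and compared with any other one, through its factor system.

  As a set-valued functor, \<open>A\<close> is represented by \<open>R\<close>.  A lift of the universal element of \<open>A\<close> to
  \<open>C\<^sub>0\<close> therefore yields natural maps \<open>\<sigma> : V \<rightarrow> C\<^sub>0(V)\<close> of sets with \<open>a \<sigma> = id\<close> and \<open>\<sigma> 0 = 0\<close>.
  The defect \<open>\<sigma> x + \<sigma> y - \<sigma> (x + y)\<close> lies in \<open>Ker a = Im d\<close>; lifting it at the universal pair of
  elements gives \<open>\<gamma>(x, y)\<close> in \<open>C\<^sub>1(V)\<close>, natural in \<open>V\<close>, which can be chosen to vanish when \<open>x\<close> or
  \<open>y\<close> is zero (\<open>exists_natural_cocycle\<close>).

  Associativity and symmetry of \<open>\<gamma>\<close> hold after applying \<open>d\<close>, so their failure is measured by natural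
  families in \<open>B = Ker d\<close>, and these vanish when the first variable, or all the others, are
  zero.  The functor \<open>B\<close> is additive, and a natural family of elements of an additive functor with
  this property is zero: evaluate at the universal triple and decompose the identity of \<open>R\<^sup>3\<close> into
  two projections (\<open>natural_family_eqI\<close>).  This is an elementary form of the vanishing of
  \<open>Ext\<^sup>1(A, B)\<close> and \<open>Ext\<^sup>2(A, B)\<close>.

  Hence \<open>\<gamma>\<close> is a symmetric normalized cocycle and defines an abelian group structure on
  \<open>C\<^sub>1(V) \<times> V\<close>, natural in \<open>V\<close>; with the map \<open>(x, v) \<mapsto> d x + \<sigma> v\<close> to \<open>C\<^sub>0(V)\<close> it is a splitting
  (\<open>splitting_extension\<close>).  Conversely, \<open>\<sigma>\<close> lifts to any given splitting \<open>S\<close>, with factor system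
  \<open>\<gamma>\<close> again, by the same principle about additive functors (\<open>glue_cocycle\<close>).  So all splittings are
  isomorphic to the one constructed, compatibly with the maps from \<open>C\<^sub>1\<close> and to \<open>C\<^sub>0\<close>
  (\<open>splittings_isomorphic\<close>).
\<close>

section \<open>Modules\<close>

lemma (in left_module) smult_zero_left: "x \<in> carrier M \<Longrightarrow> \<zero>\<^bsub>R\<^esub> \<odot>\<^bsub>M\<^esub> x = \<zero>\<^bsub>M\<^esub>"
  by (metis M.add.l_cancel_one R.add.one_closed R.l_zero smult_closed smult_l_distr)

lemma (in left_module) smult_zero_right: "r \<in> carrier R \<Longrightarrow> r \<odot>\<^bsub>M\<^esub> \<zero>\<^bsub>M\<^esub> = \<zero>\<^bsub>M\<^esub>"
  by (metis M.add.l_cancel_one M.zero_closed M.l_zero smult_closed smult_r_distr)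

lemma linear_maps_closed:
  "f \<in> linear_maps R M N \<Longrightarrow> x \<in> carrier M \<Longrightarrow> f x \<in> carrier N"
  by (auto simp: linear_maps_def)

lemma linear_maps_add:
  "f \<in> linear_maps R M N \<Longrightarrow> x \<in> carrier M \<Longrightarrow> y \<in> carrier M \<Longrightarrow>
   f (x \<oplus>\<^bsub>M\<^esub> y) = f x \<oplus>\<^bsub>N\<^esub> f y"
  by (auto simp: linear_maps_def)

lemma linear_maps_smult:
  "f \<in> linear_maps R M N \<Longrightarrow> r \<in> carrier R \<Longrightarrow> x \<in> carrier M \<Longrightarrow>
   f (r \<odot>\<^bsub>M\<^esub> x) = r \<odot>\<^bsub>N\<^esub> f x"
  by (auto simp: linear_maps_def)

lemma linear_maps_zero:
  assumes "left_module R M" "left_module R N" "f \<in> linear_maps R M N"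
  shows "f \<zero>\<^bsub>M\<^esub> = \<zero>\<^bsub>N\<^esub>"
proof -
  interpret M: left_module R M by fact
  interpret N: left_module R N by fact
  have "f \<zero>\<^bsub>M\<^esub> \<oplus>\<^bsub>N\<^esub> f \<zero>\<^bsub>M\<^esub> = f \<zero>\<^bsub>M\<^esub>"
    using linear_maps_add[OF assms(3), of "\<zero>\<^bsub>M\<^esub>" "\<zero>\<^bsub>M\<^esub>"] by simp
  then show ?thesis
    using linear_maps_closed[OF assms(3), of "\<zero>\<^bsub>M\<^esub>"] N.M.add.l_cancel_one by simp
qed

lemma linear_maps_compose:
  assumes "left_module R M" "f \<in> linear_maps R M N" "g \<in> linear_maps R N K"
  shows "compose (carrier M) g f \<in> linear_maps R M K"
proof -
  interpret M: left_module R M by fact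
  show ?thesis
    using assms(2,3) by (auto simp: linear_maps_def compose_eq M.smult_closed PiE_iff)
qed

lemma linear_maps_zero_map:
  assumes "left_module R M" "left_module R N"
  shows "(\<lambda>x\<in>carrier M. \<zero>\<^bsub>N\<^esub>) \<in> linear_maps R M N"
proof -
  interpret M: left_module R M by fact
  interpret N: left_module R N by fact
  show ?thesis by (simp add: linear_maps_def M.smult_closed N.smult_zero_right)
qed

lemma linear_maps_sum:
  assumes "left_module R M" "left_module R N" "f \<in> linear_maps R M N" "g \<in> linear_maps R M N"
  shows "(\<lambda>x\<in>carrier M. f x \<oplus>\<^bsub>N\<^esub> g x) \<in> linear_maps R M N"
proof -
  interpret M: left_module R M by fact
  interpret N: left_module R N by fact
  show ?thesis
    using assms(3,4)
    by (auto simp: linear_maps_def M.smult_closed N.smult_r_distr PiE_iff N.M.add.m_ac)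
qed

lemma proj_modulesD: "V \<in> proj_modules R \<Longrightarrow> left_module R V"
  by (simp add: proj_modules_def)

lemma proj_modules_abelian: "V \<in> proj_modules R \<Longrightarrow> abelian_group V"
  by (meson proj_modulesD left_module.axioms(2))

text \<open>Pointedness of a functor concerns zero modules only; a zero module in the universe of modules
  is what turns it into a statement about zero maps.\<close>

lemma exists_zero_proj_module:
  assumes "ring R"
  obtains Z :: "('r, 'v) module" where "Z \<in> proj_modules R" "carrier Z = {\<zero>\<^bsub>Z\<^esub>}"
proof
  let ?Z = "\<lparr>carrier = {undefined}, monoid.mult = (\<lambda>x y. undefined), one = undefined, ring.zero = undefined,
    ring.add = (\<lambda>x y. undefined), smult = (\<lambda>r x. undefined)\<rparr> :: ('r, 'v) module"
  interpret R: ring R by fact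
  interpret Z: abelian_group ?Z
    by (rule abelian_groupI) auto
  have Z: "left_module R ?Z"
    by (unfold_locales) auto
  have "projective R ?Z"
    unfolding projective_def
  proof (intro allI impI)
    fix M N :: "('r, 'v) module" and g f
    assume M: "left_module R M" and N: "left_module R N" and g: "g \<in> linear_maps R M N"
      and f: "f \<in> linear_maps R ?Z N"
    have "\<forall>x\<in>carrier ?Z. g ((\<lambda>x\<in>carrier ?Z. \<zero>\<^bsub>M\<^esub>) x) = f x"
      using linear_maps_zero[OF M N g] linear_maps_zero[OF Z N f] by simp
    then show "\<exists>h\<in>linear_maps R ?Z M. \<forall>x\<in>carrier ?Z. g (h x) = f x"
      using linear_maps_zero_map[OF Z M] by blast
  qed
  moreover have "finitely_generated R ?Z"
    unfolding finitely_generated_def by (rule exI[of _ "{}"]) simp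
  ultimately show "?Z \<in> proj_modules R" using Z by (simp add: proj_modules_def)
  show "carrier ?Z = {\<zero>\<^bsub>?Z\<^esub>}" by simp
qed

section \<open>A free module of rank three\<close>

text \<open>Freeness is expressed by the universal property: \<open>ev V x y z\<close> is the linear map sending the
  basis to \<open>x\<close>, \<open>y\<close>, \<open>z\<close>.  Rank three is what the associativity of an addition involves.\<close>

locale free_triple = ring R for R :: "('r, 'k) ring_scheme" +
  fixes P :: "('r, 'v) module" and e1 e2 e3 :: 'v
    and ev :: "('r, 'v) module \<Rightarrow> 'v \<Rightarrow> 'v \<Rightarrow> 'v \<Rightarrow> 'v \<Rightarrow> 'v"
  assumes P_proj: "P \<in> proj_modules R"
    and e_closed: "e1 \<in> carrier P" "e2 \<in> carrier P" "e3 \<in> carrier P"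
    and ev_linear: "\<And>V v1 v2 v3. \<lbrakk>left_module R V; v1 \<in> carrier V; v2 \<in> carrier V; v3 \<in> carrier V\<rbrakk>
      \<Longrightarrow> ev V v1 v2 v3 \<in> linear_maps R P V"
    and ev_basis: "\<And>V v1 v2 v3. \<lbrakk>left_module R V; v1 \<in> carrier V; v2 \<in> carrier V; v3 \<in> carrier V\<rbrakk>
      \<Longrightarrow> ev V v1 v2 v3 e1 = v1 \<and> ev V v1 v2 v3 e2 = v2 \<and> ev V v1 v2 v3 e3 = v3"
    and basis_eqI: "\<And>(V :: ('r, 'v) module) f g. \<lbrakk>left_module R V; f \<in> linear_maps R P V; g \<in> linear_maps R P V;
      f e1 = g e1; f e2 = g e2; f e3 = g e3\<rbrakk> \<Longrightarrow> f = g"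

lemma exists_free_triple:
  fixes R :: "('r, 'k) ring_scheme" and u :: "'r list \<Rightarrow> 'v"
  assumes "ring R" "inj u"
  obtains P e1 e2 e3 and ev :: "('r, 'v) module \<Rightarrow> 'v \<Rightarrow> 'v \<Rightarrow> 'v \<Rightarrow> 'v \<Rightarrow> 'v"
  where "free_triple R P e1 e2 e3 ev"
proof -
  interpret R: ring R by fact
  \<comment> \<open>Lists of length three over \<open>R\<close>, carried into the universe of modules by \<open>u\<close>.\<close>
  define t where "t x y z = u [x, y, z]" for x y z
  define coord where "coord i p = inv_into UNIV u p ! i" for i p
  have coord: "coord 0 (t x y z) = x" "coord (Suc 0) (t x y z) = y" "coord (Suc (Suc 0)) (t x y z) = z"
    for x y z
    using \<open>inj u\<close> by (simp_all add: coord_def t_def)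
  define P :: "('r, 'v) module" where
    "P = \<lparr>carrier = {t x y z | x y z. x \<in> carrier R \<and> y \<in> carrier R \<and> z \<in> carrier R},
      monoid.mult = undefined, one = undefined, ring.zero = t \<zero>\<^bsub>R\<^esub> \<zero>\<^bsub>R\<^esub> \<zero>\<^bsub>R\<^esub>,
      ring.add = (\<lambda>p q. t (coord 0 p \<oplus>\<^bsub>R\<^esub> coord 0 q) (coord 1 p \<oplus>\<^bsub>R\<^esub> coord 1 q) (coord 2 p \<oplus>\<^bsub>R\<^esub> coord 2 q)),
      smult = (\<lambda>r p. t (r \<otimes>\<^bsub>R\<^esub> coord 0 p) (r \<otimes>\<^bsub>R\<^esub> coord 1 p) (r \<otimes>\<^bsub>R\<^esub> coord 2 p))\<rparr>"
  have carrier: "p \<in> carrier P \<longleftrightarrow>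
      (\<exists>x y z. p = t x y z \<and> x \<in> carrier R \<and> y \<in> carrier R \<and> z \<in> carrier R)" for p
    by (simp add: P_def)
  have carrierE: thesis
    if "p \<in> carrier P" "\<And>x y z. \<lbrakk>p = t x y z; x \<in> carrier R; y \<in> carrier R; z \<in> carrier R\<rbrakk> \<Longrightarrow> thesis"
    for p thesis using that carrier by blast
  have t_closed: "t x y z \<in> carrier P"
    if "x \<in> carrier R" "y \<in> carrier R" "z \<in> carrier R" for x y z
    using that carrier by blast
  have add: "t x y z \<oplus>\<^bsub>P\<^esub> t x' y' z' = t (x \<oplus>\<^bsub>R\<^esub> x') (y \<oplus>\<^bsub>R\<^esub> y') (z \<oplus>\<^bsub>R\<^esub> z')"
    for x y z x' y' z' by (simp add: P_def coord numeral_2_eq_2)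
  have smult: "r \<odot>\<^bsub>P\<^esub> t x y z = t (r \<otimes>\<^bsub>R\<^esub> x) (r \<otimes>\<^bsub>R\<^esub> y) (r \<otimes>\<^bsub>R\<^esub> z)" for r x y z
    by (simp add: P_def coord numeral_2_eq_2)
  have zero: "\<zero>\<^bsub>P\<^esub> = t \<zero>\<^bsub>R\<^esub> \<zero>\<^bsub>R\<^esub> \<zero>\<^bsub>R\<^esub>" by (simp add: P_def)
  interpret P: abelian_group P
  proof (rule abelian_groupI)
    fix p assume "p \<in> carrier P"
    then obtain x y z where p: "p = t x y z" "x \<in> carrier R" "y \<in> carrier R" "z \<in> carrier R"
      using carrier by blast
    have "t (\<ominus>\<^bsub>R\<^esub> x) (\<ominus>\<^bsub>R\<^esub> y) (\<ominus>\<^bsub>R\<^esub> z) \<in> carrier P" using p t_closed by simp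
    moreover have "t (\<ominus>\<^bsub>R\<^esub> x) (\<ominus>\<^bsub>R\<^esub> y) (\<ominus>\<^bsub>R\<^esub> z) \<oplus>\<^bsub>P\<^esub> p = \<zero>\<^bsub>P\<^esub>"
      using p by (simp add: add zero R.l_neg)
    ultimately show "\<exists>q\<in>carrier P. q \<oplus>\<^bsub>P\<^esub> p = \<zero>\<^bsub>P\<^esub>" by blast
  qed (auto simp: add zero R.a_ac t_closed elim!: carrierE)
  have P: "left_module R P"
    by unfold_locales
      (auto simp: add smult R.l_distr R.r_distr R.m_assoc t_closed elim!: carrierE)
  define e1 where "e1 = t \<one>\<^bsub>R\<^esub> \<zero>\<^bsub>R\<^esub> \<zero>\<^bsub>R\<^esub>"
  define e2 where "e2 = t \<zero>\<^bsub>R\<^esub> \<one>\<^bsub>R\<^esub> \<zero>\<^bsub>R\<^esub>"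
  define e3 where "e3 = t \<zero>\<^bsub>R\<^esub> \<zero>\<^bsub>R\<^esub> \<one>\<^bsub>R\<^esub>"
  have e: "e1 \<in> carrier P" "e2 \<in> carrier P" "e3 \<in> carrier P"
    by (simp_all add: e1_def e2_def e3_def t_closed)
  have expand: "t x y z = x \<odot>\<^bsub>P\<^esub> e1 \<oplus>\<^bsub>P\<^esub> (y \<odot>\<^bsub>P\<^esub> e2 \<oplus>\<^bsub>P\<^esub> z \<odot>\<^bsub>P\<^esub> e3)"
    if "x \<in> carrier R" "y \<in> carrier R" "z \<in> carrier R" for x y z
    using that by (simp add: e1_def e2_def e3_def add smult)
  define ev where "ev V v1 v2 v3 = (\<lambda>p\<in>carrier P.
      coord 0 p \<odot>\<^bsub>V\<^esub> v1 \<oplus>\<^bsub>V\<^esub> (coord 1 p \<odot>\<^bsub>V\<^esub> v2 \<oplus>\<^bsub>V\<^esub> coord 2 p \<odot>\<^bsub>V\<^esub> v3))"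
    for V :: "('r, 'v) module" and v1 v2 v3
  have ev_t: "ev V v1 v2 v3 (t x y z) = x \<odot>\<^bsub>V\<^esub> v1 \<oplus>\<^bsub>V\<^esub> (y \<odot>\<^bsub>V\<^esub> v2 \<oplus>\<^bsub>V\<^esub> z \<odot>\<^bsub>V\<^esub> v3)"
    if "x \<in> carrier R" "y \<in> carrier R" "z \<in> carrier R" for V v1 v2 v3 x y z
    using that by (simp add: ev_def t_closed coord numeral_2_eq_2)
  have ev_linear: "ev V v1 v2 v3 \<in> linear_maps R P V"
    if "left_module R V" "v1 \<in> carrier V" "v2 \<in> carrier V" "v3 \<in> carrier V" for V v1 v2 v3
  proof -
    interpret V: left_module R V by fact
    have "ev V v1 v2 v3 \<in> extensional (carrier P)" by (simp add: ev_def)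
    then show ?thesis
      using that(2-)
      by (auto simp: linear_maps_def PiE_iff add smult ev_t V.smult_closed
          V.smult_l_distr V.smult_r_distr V.smult_assoc V.M.add.m_ac elim!: carrierE)
  qed
  have ev_basis: "ev V v1 v2 v3 e1 = v1 \<and> ev V v1 v2 v3 e2 = v2 \<and> ev V v1 v2 v3 e3 = v3"
    if "left_module R V" "v1 \<in> carrier V" "v2 \<in> carrier V" "v3 \<in> carrier V" for V v1 v2 v3
  proof -
    interpret V: left_module R V by fact
    show ?thesis
      using that(2-) by (simp add: e1_def e2_def e3_def ev_t V.smult_one V.smult_zero_left)
  qed
  have basis_eqI: "f = g"
    if "left_module R V" and f: "f \<in> linear_maps R P V" and g: "g \<in> linear_maps R P V"
      and eq: "f e1 = g e1" "f e2 = g e2" "f e3 = g e3"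
    for V :: "('r, 'v) module" and f g
  proof (rule extensionalityI[of f "carrier P"])
    interpret P: left_module R P by fact
    fix p assume "p \<in> carrier P"
    then obtain x y z where p: "p = t x y z" "x \<in> carrier R" "y \<in> carrier R" "z \<in> carrier R"
      using carrier by blast
    show "f p = g p"
      using p(2-) eq unfolding p(1) expand[OF p(2-)]
      by (simp add: linear_maps_add[OF f] linear_maps_smult[OF f]
          linear_maps_add[OF g] linear_maps_smult[OF g] e P.smult_closed)
  qed (use f g in \<open>auto simp: linear_maps_def PiE_iff\<close>)
  have "projective R P"
    unfolding projective_def
  proof (intro allI impI)
    fix M N :: "('r, 'v) module" and g f
    assume M: "left_module R M" and N: "left_module R N" and g: "g \<in> linear_maps R M N"
      and surj: "g ` carrier M = carrier N" and f: "f \<in> linear_maps R P N"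
    have "\<exists>m\<in>carrier M. g m = f p" if "p \<in> carrier P" for p
      using linear_maps_closed[OF f that] surj by (metis imageE)
    then obtain m1 m2 m3 where m: "m1 \<in> carrier M" "m2 \<in> carrier M" "m3 \<in> carrier M"
        "g m1 = f e1" "g m2 = f e2" "g m3 = f e3"
      using e by metis
    let ?h = "ev M m1 m2 m3"
    have h: "?h \<in> linear_maps R P M" using ev_linear[OF M] m by simp
    have "compose (carrier P) g ?h = f"
      using m e ev_basis[OF M] by (intro basis_eqI[OF N linear_maps_compose[OF P h g] f])
        (simp_all add: compose_eq)
    then have "\<forall>x\<in>carrier P. g (?h x) = f x" by (metis compose_eq)
    then show "\<exists>h\<in>linear_maps R P M. \<forall>x\<in>carrier P. g (h x) = f x" using h by blast
  qed
  moreover have "finitely_generated R P"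
  proof (cases "\<one>\<^bsub>R\<^esub> = \<zero>\<^bsub>R\<^esub>")
    \<comment> \<open>Over the zero ring the three basis elements coincide, so a linear combination cannot be
      indexed by the set of them.\<close>
    case True
    then have "carrier R = {\<zero>\<^bsub>R\<^esub>}" by (simp add: R.one_zeroD)
    then have "p = \<zero>\<^bsub>P\<^esub>" if "p \<in> carrier P" for p
      using that by (auto simp: zero elim!: carrierE)
    then show ?thesis
      unfolding finitely_generated_def by (intro exI[of _ "{}"]) auto
  next
    case False
    have ne: "e1 \<noteq> e2" "e1 \<noteq> e3" "e2 \<noteq> e3"
      using False unfolding e1_def e2_def e3_def by (metis coord)+
    interpret P: left_module R P by fact
    have "\<exists>k\<in>{e1, e2, e3} \<rightarrow> carrier R. p = (\<Oplus>\<^bsub>P\<^esub>s\<in>{e1, e2, e3}. k s \<odot>\<^bsub>P\<^esub> s)"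
      if "p \<in> carrier P" for p
    proof -
      obtain x y z where p: "p = t x y z" "x \<in> carrier R" "y \<in> carrier R" "z \<in> carrier R"
        using carrier \<open>p \<in> carrier P\<close> by blast
      let ?k = "\<lambda>s. if s = e1 then x else if s = e2 then y else z"
      have "(\<Oplus>\<^bsub>P\<^esub>s\<in>{e1, e2, e3}. ?k s \<odot>\<^bsub>P\<^esub> s) = p"
        using p ne e unfolding p(1) expand[OF p(2-)] by (simp add: P.smult_closed)
      then show ?thesis using p by (intro bexI[of _ ?k]) auto
    qed
    then show ?thesis
      unfolding finitely_generated_def using e by (intro exI[of _ "{e1, e2, e3}"]) simp
  qed
  ultimately have "P \<in> proj_modules R" using P by (simp add: proj_modules_def)
  then have "free_triple R P e1 e2 e3 ev"
    using e ev_linear ev_basis basis_eqI by unfold_locales auto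
  then show thesis by (rule that)
qed

section \<open>Pointed functors\<close>

lemma pointed_functor_comm_group:
  "pointed_functor R F \<Longrightarrow> V \<in> proj_modules R \<Longrightarrow> comm_group (fobj F V)"
  by (simp add: pointed_functor_def)

lemma pointed_functor_hom:
  "\<lbrakk>pointed_functor R F; V \<in> proj_modules R; V' \<in> proj_modules R; f \<in> linear_maps R V V'\<rbrakk> \<Longrightarrow>
   fmap F V V' f \<in> hom (fobj F V) (fobj F V')"
  by (simp add: pointed_functor_def)

lemma pointed_functor_group_hom:
  "\<lbrakk>pointed_functor R F; V \<in> proj_modules R; V' \<in> proj_modules R; f \<in> linear_maps R V V'\<rbrakk> \<Longrightarrow>
   group_hom (fobj F V) (fobj F V') (fmap F V V' f)"
  by (simp add: group_hom_def group_hom_axioms_def pointed_functor_hom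
      pointed_functor_comm_group comm_group.axioms(2))

lemma pointed_functor_id:
  "\<lbrakk>pointed_functor R F; V \<in> proj_modules R; x \<in> carrier (fobj F V)\<rbrakk> \<Longrightarrow>
   fmap F V V (\<lambda>v\<in>carrier V. v) x = x"
  unfolding pointed_functor_def by blast

lemma pointed_functor_compose:
  "\<lbrakk>pointed_functor R F; V \<in> proj_modules R; V' \<in> proj_modules R; V'' \<in> proj_modules R;
    f \<in> linear_maps R V V'; g \<in> linear_maps R V' V''; x \<in> carrier (fobj F V)\<rbrakk> \<Longrightarrow>
   fmap F V V'' (compose (carrier V) g f) x = fmap F V' V'' g (fmap F V V' f x)"
  unfolding pointed_functor_def by blast

text \<open>A zero map factors through a zero module, on which a pointed functor vanishes.\<close>

lemma pointed_functor_zero_map: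
  fixes V V' :: "('r, 'v) module"
  assumes R: "ring R" and F: "pointed_functor R F" and V: "V \<in> proj_modules R"
    and V': "V' \<in> proj_modules R" and x: "x \<in> carrier (fobj F V)"
  shows "fmap F V V' (\<lambda>v\<in>carrier V. \<zero>\<^bsub>V'\<^esub>) x = \<one>\<^bsub>fobj F V'\<^esub>"
proof -
  obtain Z :: "('r, 'v) module" where Z: "Z \<in> proj_modules R" "carrier Z = {\<zero>\<^bsub>Z\<^esub>}"
    using exists_zero_proj_module[OF R] .
  let ?f = "\<lambda>v\<in>carrier V. \<zero>\<^bsub>Z\<^esub>" and ?g = "\<lambda>v\<in>carrier Z. \<zero>\<^bsub>V'\<^esub>"
  have f: "?f \<in> linear_maps R V Z" and g: "?g \<in> linear_maps R Z V'"
    by (intro linear_maps_zero_map proj_modulesD V V' Z)+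
  interpret f: group_hom "fobj F V" "fobj F Z" "fmap F V Z ?f"
    by (rule pointed_functor_group_hom[OF F V Z(1) f])
  interpret g: group_hom "fobj F Z" "fobj F V'" "fmap F Z V' ?g"
    by (rule pointed_functor_group_hom[OF F Z(1) V' g])
  have "carrier (fobj F Z) = {\<one>\<^bsub>fobj F Z\<^esub>}"
    using F Z unfolding pointed_functor_def by blast
  then have "fmap F V Z ?f x = \<one>\<^bsub>fobj F Z\<^esub>" using f.hom_closed[OF x] by auto
  moreover have "(\<lambda>v\<in>carrier V. \<zero>\<^bsub>V'\<^esub>) = compose (carrier V) ?g ?f"
    using Z by (auto simp: compose_def)
  ultimately show ?thesis
    using pointed_functor_compose[OF F V Z(1) V' f g x] by simp
qed

lemma natural_transformation_group_hom:
  "\<lbrakk>pointed_functor R F; pointed_functor R G; natural_transformation R F G \<eta>; V \<in> proj_modules R\<rbrakk>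
   \<Longrightarrow> group_hom (fobj F V) (fobj G V) (\<eta> V)"
  by (simp add: group_hom_def group_hom_axioms_def natural_transformation_def
      pointed_functor_comm_group comm_group.axioms(2))

lemma natural_transformation_fmap:
  "\<lbrakk>natural_transformation R F G \<eta>; V \<in> proj_modules R; V' \<in> proj_modules R;
    f \<in> linear_maps R V V'; x \<in> carrier (fobj F V)\<rbrakk> \<Longrightarrow>
   \<eta> V' (fmap F V V' f x) = fmap G V V' f (\<eta> V x)"
  unfolding natural_transformation_def by blast

lemma carrier_forgetful [simp]: "carrier (fobj forgetful_functor V) = carrier V"
  and mult_forgetful [simp]: "x \<otimes>\<^bsub>fobj forgetful_functor V\<^esub> y = x \<oplus>\<^bsub>V\<^esub> y"
  and one_forgetful [simp]: "\<one>\<^bsub>fobj forgetful_functor V\<^esub> = \<zero>\<^bsub>V\<^esub>"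
  and fmap_forgetful [simp]: "fmap forgetful_functor V V' f = f"
  by (simp_all add: forgetful_functor_def)

section \<open>Natural families of elements\<close>

text \<open>A natural family is a natural transformation of set-valued functors from \<open>V \<mapsto> V \<times> V \<times> V\<close> to
  \<open>F\<close>.  Families in fewer variables are treated as families that ignore the remaining ones.\<close>

definition natural_family ::
    "('r, 'k) ring_scheme \<Rightarrow> ('r, 'v, 'c) ab_functor \<Rightarrow> (('r, 'v) module \<Rightarrow> 'v \<Rightarrow> 'v \<Rightarrow> 'v \<Rightarrow> 'c) \<Rightarrow> bool"
  where "natural_family R F \<beta> \<longleftrightarrow>
    (\<forall>V\<in>proj_modules R. \<forall>x\<in>carrier V. \<forall>y\<in>carrier V. \<forall>z\<in>carrier V.
       \<beta> V x y z \<in> carrier (fobj F V)) \<and>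
    (\<forall>V\<in>proj_modules R. \<forall>V'\<in>proj_modules R. \<forall>f\<in>linear_maps R V V'.
       \<forall>x\<in>carrier V. \<forall>y\<in>carrier V. \<forall>z\<in>carrier V.
       fmap F V V' f (\<beta> V x y z) = \<beta> V' (f x) (f y) (f z))"

lemma natural_family_closed:
  "\<lbrakk>natural_family R F \<beta>; V \<in> proj_modules R; x \<in> carrier V; y \<in> carrier V; z \<in> carrier V\<rbrakk>
   \<Longrightarrow> \<beta> V x y z \<in> carrier (fobj F V)"
  by (simp add: natural_family_def)

lemma natural_family_fmap:
  "\<lbrakk>natural_family R F \<beta>; V \<in> proj_modules R; V' \<in> proj_modules R; f \<in> linear_maps R V V';
    x \<in> carrier V; y \<in> carrier V; z \<in> carrier V\<rbrakk>
   \<Longrightarrow> fmap F V V' f (\<beta> V x y z) = \<beta> V' (f x) (f y) (f z)"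
  by (simp add: natural_family_def)

lemma natural_family_mult:
  fixes F :: "('r, 'v, 'c) ab_functor"
  assumes F: "pointed_functor R F" and "natural_family R F \<beta>" "natural_family R F \<beta>'"
  shows "natural_family R F (\<lambda>V x y z. \<beta> V x y z \<otimes>\<^bsub>fobj F V\<^esub> \<beta>' V x y z)"
  unfolding natural_family_def
proof (intro conjI ballI)
  fix V :: "('r, 'v) module" and x y z
  assume V: "V \<in> proj_modules R" and v: "x \<in> carrier V" "y \<in> carrier V" "z \<in> carrier V"
  interpret V: comm_group "fobj F V" by (rule pointed_functor_comm_group[OF F V])
  note closed = natural_family_closed[OF assms(2) V v] natural_family_closed[OF assms(3) V v]
  show "\<beta> V x y z \<otimes>\<^bsub>fobj F V\<^esub> \<beta>' V x y z \<in> carrier (fobj F V)" using closed by simp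
  fix V' :: "('r, 'v) module" and f assume V': "V' \<in> proj_modules R" and f: "f \<in> linear_maps R V V'"
  interpret f: group_hom "fobj F V" "fobj F V'" "fmap F V V' f"
    by (rule pointed_functor_group_hom[OF F V V' f])
  show "fmap F V V' f (\<beta> V x y z \<otimes>\<^bsub>fobj F V\<^esub> \<beta>' V x y z) =
      \<beta> V' (f x) (f y) (f z) \<otimes>\<^bsub>fobj F V'\<^esub> \<beta>' V' (f x) (f y) (f z)"
    using closed by (simp add: natural_family_fmap[OF assms(2) V V' f v]
        natural_family_fmap[OF assms(3) V V' f v])
qed

lemma natural_family_inverse:
  fixes F :: "('r, 'v, 'c) ab_functor"
  assumes F: "pointed_functor R F" and "natural_family R F \<beta>"
  shows "natural_family R F (\<lambda>V x y z. inv\<^bsub>fobj F V\<^esub> \<beta> V x y z)"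
  unfolding natural_family_def
proof (intro conjI ballI)
  fix V :: "('r, 'v) module" and x y z
  assume V: "V \<in> proj_modules R" and v: "x \<in> carrier V" "y \<in> carrier V" "z \<in> carrier V"
  interpret V: comm_group "fobj F V" by (rule pointed_functor_comm_group[OF F V])
  note closed = natural_family_closed[OF assms(2) V v]
  show "inv\<^bsub>fobj F V\<^esub> \<beta> V x y z \<in> carrier (fobj F V)" using closed by simp
  fix V' :: "('r, 'v) module" and f assume V': "V' \<in> proj_modules R" and f: "f \<in> linear_maps R V V'"
  interpret f: group_hom "fobj F V" "fobj F V'" "fmap F V V' f"
    by (rule pointed_functor_group_hom[OF F V V' f])
  show "fmap F V V' f (inv\<^bsub>fobj F V\<^esub> \<beta> V x y z) = inv\<^bsub>fobj F V'\<^esub> \<beta> V' (f x) (f y) (f z)"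
    using closed by (simp add: natural_family_fmap[OF assms(2) V V' f v])
qed

text \<open>The substituted expressions are natural families in the forgetful functor, such as a variable,
  zero, or a sum of two expressions.\<close>

lemma natural_family_substitute:
  assumes "natural_family R F \<beta>"
    and subst: "\<And>p. p \<in> {p1, p2, p3} \<Longrightarrow>
      natural_family R forgetful_functor p"
  shows "natural_family R F (\<lambda>V x y z. \<beta> V (p1 V x y z) (p2 V x y z) (p3 V x y z))"
  using assms(1) subst[of p1] subst[of p2] subst[of p3]
  by (simp add: natural_family_def)

lemma natural_family_coordinates:
  "natural_family R forgetful_functor (\<lambda>V x y z. x)"
  "natural_family R forgetful_functor (\<lambda>V x y z. y)"
  "natural_family R forgetful_functor (\<lambda>V x y z. z)"
  by (simp_all add: natural_family_def)

lemma natural_family_zero: "natural_family R forgetful_functor (\<lambda>V x y z. \<zero>\<^bsub>V\<^esub>)"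
  by (auto simp: natural_family_def abelian_monoid.zero_closed
      abelian_group.axioms(1)[OF proj_modules_abelian]
      intro: linear_maps_zero[OF proj_modulesD proj_modulesD])

lemma natural_family_add:
  assumes "natural_family R forgetful_functor p" "natural_family R forgetful_functor q"
  shows "natural_family R forgetful_functor (\<lambda>V x y z. p V x y z \<oplus>\<^bsub>V\<^esub> q V x y z)"
  using assms
  by (auto simp: natural_family_def linear_maps_add abelian_monoid.a_closed
      abelian_group.axioms(1)[OF proj_modules_abelian])

context free_triple
begin

lemma ev_compose:
  assumes V: "left_module R V" and V': "left_module R V'" and f: "f \<in> linear_maps R V V'"
    and v: "x \<in> carrier V" "y \<in> carrier V" "z \<in> carrier V"
  shows "compose (carrier P) f (ev V x y z) = ev V' (f x) (f y) (f z)"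
proof -
  have fv: "f x \<in> carrier V'" "f y \<in> carrier V'" "f z \<in> carrier V'"
    using linear_maps_closed[OF f] v by auto
  show ?thesis
    by (rule basis_eqI[OF V' linear_maps_compose[OF proj_modulesD[OF P_proj] ev_linear[OF V v] f]
          ev_linear[OF V' fv]])
      (simp_all add: compose_eq e_closed ev_basis[OF V v] ev_basis[OF V' fv])
qed

text \<open>Since \<open>V \<times> V \<times> V\<close> is represented by \<open>P\<close>, this is the Yoneda correspondence: every element
  of \<open>F(P)\<close> gives a natural family.\<close>

lemma natural_family_fmap_ev:
  fixes F :: "('r, 'v, 'c) ab_functor"
  assumes F: "pointed_functor R F" and g: "g \<in> carrier (fobj F P)"
  shows "natural_family R F (\<lambda>V x y z. fmap F P V (ev V x y z) g)"
  unfolding natural_family_def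
proof (intro conjI ballI)
  fix V :: "('r, 'v) module" and x y z
  assume V: "V \<in> proj_modules R" and v: "x \<in> carrier V" "y \<in> carrier V" "z \<in> carrier V"
  note ev = ev_linear[OF proj_modulesD[OF V] v]
  interpret f: group_hom "fobj F P" "fobj F V" "fmap F P V (ev V x y z)"
    by (rule pointed_functor_group_hom[OF F P_proj V ev])
  show "fmap F P V (ev V x y z) g \<in> carrier (fobj F V)" using g by simp
  fix V' :: "('r, 'v) module" and f assume V': "V' \<in> proj_modules R" and f: "f \<in> linear_maps R V V'"
  show "fmap F V V' f (fmap F P V (ev V x y z) g) = fmap F P V' (ev V' (f x) (f y) (f z)) g"
    unfolding ev_compose[OF proj_modulesD[OF V] proj_modulesD[OF V'] f v, symmetric]
    by (rule pointed_functor_compose[OF F P_proj V V' ev f g, symmetric])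
qed

lemma fmap_ev_zero:
  assumes F: "pointed_functor R F" and g: "g \<in> carrier (fobj F P)" and V: "V \<in> proj_modules R"
  shows "fmap F P V (ev V \<zero>\<^bsub>V\<^esub> \<zero>\<^bsub>V\<^esub> \<zero>\<^bsub>V\<^esub>) g = \<one>\<^bsub>fobj F V\<^esub>"
proof -
  interpret V: left_module R V by (rule proj_modulesD[OF V])
  have z: "\<zero>\<^bsub>V\<^esub> \<in> carrier V" by simp
  have L: "left_module R V" by (rule proj_modulesD[OF V])
  have "ev V \<zero>\<^bsub>V\<^esub> \<zero>\<^bsub>V\<^esub> \<zero>\<^bsub>V\<^esub> = (\<lambda>v\<in>carrier P. \<zero>\<^bsub>V\<^esub>)"
    by (rule basis_eqI[OF L ev_linear[OF L z z z] linear_maps_zero_map[OF proj_modulesD[OF P_proj] L]])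
      (simp_all add: ev_basis[OF L z z z] e_closed)
  then show ?thesis
    using pointed_functor_zero_map[OF ring_axioms F P_proj V g] by simp
qed

text \<open>The two summands are the projections of \<open>P\<close> onto its first coordinate and onto the other two.\<close>

lemma identity_eq_sum:
  "(\<lambda>v\<in>carrier P. v) = (\<lambda>v\<in>carrier P. ev P e1 \<zero>\<^bsub>P\<^esub> \<zero>\<^bsub>P\<^esub> v \<oplus>\<^bsub>P\<^esub> ev P \<zero>\<^bsub>P\<^esub> e2 e3 v)"
proof -
  interpret P: left_module R P by (rule proj_modulesD[OF P_proj])
  have L: "left_module R P" by (rule proj_modulesD[OF P_proj])
  have z: "\<zero>\<^bsub>P\<^esub> \<in> carrier P" by simp
  have "(\<lambda>v\<in>carrier P. v) \<in> linear_maps R P P"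
    by (auto simp: linear_maps_def P.smult_closed)
  then show ?thesis
    by (rule basis_eqI[OF L _ linear_maps_sum[OF L L ev_linear[OF L e_closed(1) z z]
          ev_linear[OF L z e_closed(2,3)]]])
      (simp_all add: e_closed ev_basis[OF L e_closed(1) z z] ev_basis[OF L z e_closed(2,3)])
qed

end

definition additive_functor :: "('r, 'k) ring_scheme \<Rightarrow> ('r, 'v, 'b) ab_functor \<Rightarrow> bool" where
  "additive_functor R F \<longleftrightarrow>
    (\<forall>V\<in>proj_modules R. \<forall>V'\<in>proj_modules R. \<forall>f\<in>linear_maps R V V'. \<forall>g\<in>linear_maps R V V'.
       \<forall>x\<in>carrier (fobj F V). fmap F V V' (\<lambda>v\<in>carrier V. f v \<oplus>\<^bsub>V'\<^esub> g v) x =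
         fmap F V V' f x \<otimes>\<^bsub>fobj F V'\<^esub> fmap F V V' g x)"

lemma additive_functor_sum:
  "\<lbrakk>additive_functor R F; V \<in> proj_modules R; V' \<in> proj_modules R; f \<in> linear_maps R V V';
    g \<in> linear_maps R V V'; x \<in> carrier (fobj F V)\<rbrakk> \<Longrightarrow>
   fmap F V V' (\<lambda>v\<in>carrier V. f v \<oplus>\<^bsub>V'\<^esub> g v) x =
     fmap F V V' f x \<otimes>\<^bsub>fobj F V'\<^esub> fmap F V V' g x"
  unfolding additive_functor_def by blast

text \<open>The difference of the values of the two families at the universal triple \<open>(e1, e2, e3)\<close> lies in
  the kernel of \<open>d\<close>, hence comes from some \<open>t\<close> in \<open>B(P)\<close>.  As \<open>B\<close> is additive, \<open>t\<close> is the sum of its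
  images under the two projections of \<open>P\<close>, and these go to the differences of the two families at
  \<open>(e1, 0, 0)\<close> and \<open>(0, e2, e3)\<close>.  So an additive functor leaves no room for a discrepancy that
  vanishes on both axes; all identities between cocycles below rest on this.\<close>

lemma (in free_triple) natural_family_eqI:
  assumes B: "pointed_functor R B" and F: "pointed_functor R F" and G: "pointed_functor R G"
    and additive: "additive_functor R B"
    and b: "natural_transformation R B F b" and d: "natural_transformation R F G d"
    and exact: "\<And>x. \<lbrakk>x \<in> carrier (fobj F P); d P x = \<one>\<^bsub>fobj G P\<^esub>\<rbrakk> \<Longrightarrow> x \<in> b P ` carrier (fobj B P)"
    and \<beta>: "natural_family R F \<beta>" and \<beta>': "natural_family R F \<beta>'"
    and eq: "d P (\<beta> P e1 e2 e3) = d P (\<beta>' P e1 e2 e3)"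
    and eq1: "\<beta> P e1 \<zero>\<^bsub>P\<^esub> \<zero>\<^bsub>P\<^esub> = \<beta>' P e1 \<zero>\<^bsub>P\<^esub> \<zero>\<^bsub>P\<^esub>"
    and eq2: "\<beta> P \<zero>\<^bsub>P\<^esub> e2 e3 = \<beta>' P \<zero>\<^bsub>P\<^esub> e2 e3"
    and V: "V \<in> proj_modules R" and v: "x \<in> carrier V" "y \<in> carrier V" "z \<in> carrier V"
  shows "\<beta> V x y z = \<beta>' V x y z"
proof -
  interpret P: left_module R P by (rule proj_modulesD[OF P_proj])
  interpret F: comm_group "fobj F P" by (rule pointed_functor_comm_group[OF F P_proj])
  interpret B: comm_group "fobj B P" by (rule pointed_functor_comm_group[OF B P_proj])
  interpret d: group_hom "fobj F P" "fobj G P" "d P"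
    by (rule natural_transformation_group_hom[OF F G d P_proj])
  interpret b: group_hom "fobj B P" "fobj F P" "b P"
    by (rule natural_transformation_group_hom[OF B F b P_proj])
  have L: "left_module R P" by (rule proj_modulesD[OF P_proj])
  have zero: "\<zero>\<^bsub>P\<^esub> \<in> carrier P" by simp
  let ?g = "\<beta> P e1 e2 e3" and ?g' = "\<beta>' P e1 e2 e3"
  let ?f1 = "ev P e1 \<zero>\<^bsub>P\<^esub> \<zero>\<^bsub>P\<^esub>" and ?f2 = "ev P \<zero>\<^bsub>P\<^esub> e2 e3"
  note closed = natural_family_closed[OF \<beta> P_proj] natural_family_closed[OF \<beta>' P_proj]
  have g: "?g \<in> carrier (fobj F P)" "?g' \<in> carrier (fobj F P)" by (simp_all add: closed e_closed)
  have f1: "?f1 \<in> linear_maps R P P" and f2: "?f2 \<in> linear_maps R P P"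
    by (simp_all add: ev_linear L e_closed)
  have "d P (?g \<otimes>\<^bsub>fobj F P\<^esub> inv\<^bsub>fobj F P\<^esub> ?g') = \<one>\<^bsub>fobj G P\<^esub>"
    using eq g by simp
  then obtain t where t: "t \<in> carrier (fobj B P)" "b P t = ?g \<otimes>\<^bsub>fobj F P\<^esub> inv\<^bsub>fobj F P\<^esub> ?g'"
    using exact[of "?g \<otimes>\<^bsub>fobj F P\<^esub> inv\<^bsub>fobj F P\<^esub> ?g'"] g by auto
  \<comment> \<open>A projection under which the two families become equal kills \<open>t\<close>, up to the kernel of \<open>b\<close>.\<close>
  have kill: "b P (fmap B P P f t) = \<one>\<^bsub>fobj F P\<^esub>"
    if f: "f \<in> linear_maps R P P" and eqf: "fmap F P P f ?g = fmap F P P f ?g'" for f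
  proof -
    interpret f: group_hom "fobj F P" "fobj F P" "fmap F P P f"
      by (rule pointed_functor_group_hom[OF F P_proj P_proj f])
    show ?thesis
      using natural_transformation_fmap[OF b P_proj P_proj f t(1)] g
      by (simp add: t(2) eqf)
  qed
  have "b P (fmap B P P ?f1 t) = \<one>\<^bsub>fobj F P\<^esub>"
    by (rule kill[OF f1]) (simp add: natural_family_fmap[OF \<beta> P_proj P_proj f1 e_closed]
        natural_family_fmap[OF \<beta>' P_proj P_proj f1 e_closed] ev_basis L e_closed eq1)
  moreover have "b P (fmap B P P ?f2 t) = \<one>\<^bsub>fobj F P\<^esub>"
    by (rule kill[OF f2]) (simp add: natural_family_fmap[OF \<beta> P_proj P_proj f2 e_closed]
        natural_family_fmap[OF \<beta>' P_proj P_proj f2 e_closed] ev_basis L e_closed eq2)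
  moreover have "t = fmap B P P ?f1 t \<otimes>\<^bsub>fobj B P\<^esub> fmap B P P ?f2 t"
    using additive_functor_sum[OF additive P_proj P_proj f1 f2 t(1)]
      pointed_functor_id[OF B P_proj t(1)] by (simp add: identity_eq_sum)
  moreover have "fmap B P P ?f1 t \<in> carrier (fobj B P)" "fmap B P P ?f2 t \<in> carrier (fobj B P)"
    by (rule hom_in_carrier[OF pointed_functor_hom[OF B P_proj P_proj f1] t(1)]
        hom_in_carrier[OF pointed_functor_hom[OF B P_proj P_proj f2] t(1)])+
  ultimately have "b P t = \<one>\<^bsub>fobj F P\<^esub>" by (metis b.hom_mult F.l_one F.one_closed)
  then have "?g \<otimes>\<^bsub>fobj F P\<^esub> inv\<^bsub>fobj F P\<^esub> ?g' = \<one>\<^bsub>fobj F P\<^esub>" by (simp add: t(2))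
  then have "?g = ?g'" using g by (metis F.inv_closed F.inv_equality F.inv_inv)
  moreover have ev: "ev V x y z \<in> linear_maps R P V" by (rule ev_linear[OF proj_modulesD[OF V] v])
  ultimately show ?thesis
    using natural_family_fmap[OF \<beta> P_proj V ev e_closed] natural_family_fmap[OF \<beta>' P_proj V ev e_closed]
    by (simp add: ev_basis[OF proj_modulesD[OF V] v])
qed

section \<open>Additivity of the tensor product\<close>

text \<open>The generators of \<^const>\<open>tensor_relations\<close>, named in order to follow them through a linear map.\<close>

definition tensor_relators ::
    "('r, 'k) ring_scheme \<Rightarrow> ('r, 'w) module \<Rightarrow> ('r, 'v) module \<Rightarrow> ('w \<times> 'v \<Rightarrow>\<^sub>0 int) set" where
  "tensor_relators R W V =
     {frag_of (w \<oplus>\<^bsub>W\<^esub> w', v) - frag_of (w, v) - frag_of (w', v) | w w' v.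
         w \<in> carrier W \<and> w' \<in> carrier W \<and> v \<in> carrier V} \<union>
     {frag_of (w, v \<oplus>\<^bsub>V\<^esub> v') - frag_of (w, v) - frag_of (w, v') | w v v'.
         w \<in> carrier W \<and> v \<in> carrier V \<and> v' \<in> carrier V} \<union>
     {frag_of (r \<odot>\<^bsub>W\<^esub> w, v) - frag_of (w, r \<odot>\<^bsub>V\<^esub> v) | r w v.
         r \<in> carrier R \<and> w \<in> carrier W \<and> v \<in> carrier V}"

lemma tensor_relations_eq_generate:
  "tensor_relations R W V =
     generate (free_Abelian_group (carrier W \<times> carrier V)) (tensor_relators R W V)"
  by (simp add: tensor_relations_def tensor_relators_def)

lemma diff_in_free_Abelian_group:
  "x \<in> carrier (free_Abelian_group S) \<Longrightarrow> y \<in> carrier (free_Abelian_group S) \<Longrightarrow>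
   x - y \<in> carrier (free_Abelian_group S)"
  using keys_diff[of x y] by auto

lemma tensor_relators_closed:
  assumes "right_module R W" "left_module R V"
  shows "tensor_relators R W V \<subseteq> carrier (free_Abelian_group (carrier W \<times> carrier V))"
proof -
  interpret W: right_module R W by fact
  interpret V: left_module R V by fact
  show ?thesis
    unfolding tensor_relators_def
    by (auto simp del: carrier_free_Abelian_group_iff simp: W.smult_closed V.smult_closed
        intro!: diff_in_free_Abelian_group)
qed

lemma tensor_relations_normal:
  assumes "right_module R W" "left_module R V"
  shows "tensor_relations R W V \<lhd> free_Abelian_group (carrier W \<times> carrier V)"
  unfolding tensor_relations_eq_generate
  by (rule comm_group.subgroup_imp_normal[OF abelian_free_Abelian_group]
      group.generate_is_subgroup[OF group_free_Abelian_group tensor_relators_closed[OF assms]])+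

lemma frag_extend_linear_closed:
  assumes f: "f \<in> linear_maps R V V'" and x: "x \<in> carrier (free_Abelian_group (carrier W \<times> carrier V))"
  shows "frag_extend (\<lambda>(w, v). frag_of (w, f v)) x \<in>
    carrier (free_Abelian_group (carrier W \<times> carrier V'))"
  using x keys_frag_extend[of "\<lambda>(w, v). frag_of (w, f v)" x] linear_maps_closed[OF f]
  by fastforce

lemma frag_extend_tensor_relations:
  assumes W: "right_module R W" and V: "left_module R V" and f: "f \<in> linear_maps R V V'"
    and x: "x \<in> tensor_relations R W V"
  shows "frag_extend (\<lambda>(w, v). frag_of (w, f v)) x \<in> tensor_relations R W V'"
proof -
  let ?F = "free_Abelian_group (carrier W \<times> carrier V)"
  let ?F' = "free_Abelian_group (carrier W \<times> carrier V')"
  let ?h = "frag_extend (\<lambda>(w, v). frag_of (w, f v))"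
  have "?h \<in> hom ?F ?F'"
    using frag_extend_linear_closed[OF f, where W = W]
    by (auto simp: frag_extend_add intro!: homI simp del: carrier_free_Abelian_group_iff)
  then interpret h: group_hom ?F ?F' ?h by (simp add: group_hom_def group_hom_axioms_def)
  have "?h r \<in> tensor_relators R W V'" if "r \<in> tensor_relators R W V" for r
  proof -
    note f_simps = frag_extend_diff linear_maps_closed[OF f] linear_maps_add[OF f] linear_maps_smult[OF f]
    consider (left) w w' v where "w \<in> carrier W" "w' \<in> carrier W" "v \<in> carrier V"
        "r = frag_of (w \<oplus>\<^bsub>W\<^esub> w', v) - frag_of (w, v) - frag_of (w', v)"
      | (right) w v v' where "w \<in> carrier W" "v \<in> carrier V" "v' \<in> carrier V"
        "r = frag_of (w, v \<oplus>\<^bsub>V\<^esub> v') - frag_of (w, v) - frag_of (w, v')"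
      | (balanced) q w v where "q \<in> carrier R" "w \<in> carrier W" "v \<in> carrier V"
        "r = frag_of (q \<odot>\<^bsub>W\<^esub> w, v) - frag_of (w, q \<odot>\<^bsub>V\<^esub> v)"
      using \<open>r \<in> tensor_relators R W V\<close> unfolding tensor_relators_def by blast
    then show ?thesis
    proof cases
      case left
      have "?h r = frag_of (w \<oplus>\<^bsub>W\<^esub> w', f v) - frag_of (w, f v) - frag_of (w', f v)"
        using left by (simp add: f_simps)
      then show ?thesis using left linear_maps_closed[OF f] unfolding tensor_relators_def by blast
    next
      case right
      have "?h r = frag_of (w, f v \<oplus>\<^bsub>V'\<^esub> f v') - frag_of (w, f v) - frag_of (w, f v')"
        using right by (simp add: f_simps)
      then show ?thesis using right linear_maps_closed[OF f] unfolding tensor_relators_def by blast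
    next
      case balanced
      have "?h r = frag_of (q \<odot>\<^bsub>W\<^esub> w, f v) - frag_of (w, q \<odot>\<^bsub>V'\<^esub> f v)"
        using balanced by (simp add: f_simps)
      then show ?thesis using balanced linear_maps_closed[OF f] unfolding tensor_relators_def by blast
    qed
  qed
  then have "generate ?F' (?h ` tensor_relators R W V) \<subseteq> tensor_relations R W V'"
    unfolding tensor_relations_eq_generate by (intro h.H.mono_generate) auto
  then show ?thesis
    using x h.generate_img[OF tensor_relators_closed[OF W V]]
    unfolding tensor_relations_eq_generate by blast
qed

lemma tensor_functor_fmap_coset:
  assumes W: "right_module R W" and V: "left_module R V" and V': "left_module R V'"
    and f: "f \<in> linear_maps R V V'"
    and x: "x \<in> carrier (free_Abelian_group (carrier W \<times> carrier V))"
  shows "fmap (tensor_functor R W) V V' f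
      (tensor_relations R W V #>\<^bsub>free_Abelian_group (carrier W \<times> carrier V)\<^esub> x) =
    tensor_relations R W V' #>\<^bsub>free_Abelian_group (carrier W \<times> carrier V')\<^esub>
      frag_extend (\<lambda>(w, v). frag_of (w, f v)) x" (is "_ = ?H' #>\<^bsub>?F'\<^esub> ?h x")
proof -
  let ?H = "tensor_relations R W V"
  let ?F = "free_Abelian_group (carrier W \<times> carrier V)"
  interpret H: normal ?H ?F by (rule tensor_relations_normal[OF W V])
  interpret H': normal ?H' ?F' by (rule tensor_relations_normal[OF W V'])
  have zero: "0 \<in> ?H" using subgroup.one_closed[OF H.subgroup_axioms] by simp
  have add: "r + s \<in> ?H'" if "r \<in> ?H'" "s \<in> ?H'" for r s
    using subgroup.m_closed[OF H'.subgroup_axioms that] by simp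
  have "{r + ?h (s + x) | r s. r \<in> ?H' \<and> s \<in> ?H} = {r + ?h x | r. r \<in> ?H'}" (is "?L = ?R")
  proof (intro equalityI subsetI)
    fix y assume "y \<in> ?L"
    then obtain r s where rs: "y = (r + ?h s) + ?h x" "r \<in> ?H'" "s \<in> ?H"
      by (auto simp: frag_extend_add add.assoc)
    then have "r + ?h s \<in> ?H'" using frag_extend_tensor_relations[OF W V f] by (intro add)
    then show "y \<in> ?R" using rs by blast
  next
    fix y assume "y \<in> ?R"
    then obtain r where "y = r + ?h (0 + x)" "r \<in> ?H'" by auto
    then show "y \<in> ?L" using zero by blast
  qed
  then show ?thesis
    by (simp add: tensor_functor_def set_mult_def r_coset_def) blast
qed

text \<open>By induction on the free generators, \<open>(f + g)x\<close> and \<open>f x + g x\<close> differ by a relation; on a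
  generator this is biadditivity in the second argument.\<close>

lemma additive_tensor_functor:
  fixes R :: "('r, 'k) ring_scheme" and W :: "('r, 'w) module"
  assumes W: "right_module R W"
  shows "additive_functor R (tensor_functor R W :: ('r, 'v, ('w \<times> 'v \<Rightarrow>\<^sub>0 int) set) ab_functor)"
  unfolding additive_functor_def
proof (intro ballI)
  fix V V' :: "('r, 'v) module" and f g X
  assume "V \<in> proj_modules R" "V' \<in> proj_modules R"
    and f: "f \<in> linear_maps R V V'" and g: "g \<in> linear_maps R V V'"
    and X: "X \<in> carrier (fobj (tensor_functor R W) V)"
  then have V: "left_module R V" and V': "left_module R V'" by (simp_all add: proj_modulesD)
  let ?T = "tensor_functor R W"
  let ?H = "tensor_relations R W V" and ?H' = "tensor_relations R W V'"
  let ?F = "free_Abelian_group (carrier W \<times> carrier V)"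
  let ?F' = "free_Abelian_group (carrier W \<times> carrier V')"
  let ?s = "\<lambda>v\<in>carrier V. f v \<oplus>\<^bsub>V'\<^esub> g v"
  let ?h = "\<lambda>f. frag_extend (\<lambda>(w, v). frag_of (w, f v))"
  interpret H: normal ?H ?F by (rule tensor_relations_normal[OF W V])
  interpret H': normal ?H' ?F' by (rule tensor_relations_normal[OF W V'])
  have s: "?s \<in> linear_maps R V V'" by (rule linear_maps_sum[OF V V' f g])
  obtain x where x: "x \<in> carrier ?F" "X = ?H #>\<^bsub>?F\<^esub> x"
    using X by (auto simp: tensor_functor_def carrier_FactGroup)
  have rel_diff: "r - t \<in> ?H'" if "r \<in> ?H'" "t \<in> ?H'" for r t
    using subgroup.m_closed[OF H'.subgroup_axioms that(1) H'.m_inv_closed[OF that(2)]]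
      H'.mem_carrier[OF that(2)] by simp
  have "Poly_Mapping.keys x \<subseteq> carrier W \<times> carrier V" using x by simp
  then have "?h ?s x - ?h f x - ?h g x \<in> ?H'"
  proof (induction x rule: frag_induction)
    case zero
    show ?case using subgroup.one_closed[OF H'.subgroup_axioms] by simp
  next
    case (one p)
    then obtain w v where p: "p = (w, v)" "w \<in> carrier W" "v \<in> carrier V" by auto
    then have "frag_of (w, f v \<oplus>\<^bsub>V'\<^esub> g v) - frag_of (w, f v) - frag_of (w, g v)
        \<in> tensor_relators R W V'"
      using linear_maps_closed[OF f] linear_maps_closed[OF g] unfolding tensor_relators_def by blast
    then show ?case
      using p by (simp add: tensor_relations_eq_generate generate.incl)
  next
    case (diff y z)
    have "?h ?s (y - z) - ?h f (y - z) - ?h g (y - z) =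
        (?h ?s y - ?h f y - ?h g y) - (?h ?s z - ?h f z - ?h g z)"
      by (simp add: frag_extend_diff)
    then show ?case using rel_diff[OF diff] by simp
  qed
  then have mem: "?h ?s x - (?h f x + ?h g x) \<in> ?H'" by (simp add: algebra_simps)
  have closed: "?h ?s x \<in> carrier ?F'" "?h f x \<in> carrier ?F'" "?h g x \<in> carrier ?F'"
    using frag_extend_linear_closed[OF _ x(1)] s f g by blast+
  have "?h ?s x \<in> ?H' #>\<^bsub>?F'\<^esub> (?h f x \<otimes>\<^bsub>?F'\<^esub> ?h g x)"
    unfolding r_coset_def mult_free_Abelian_group by (rule UN_I[OF mem]) simp
  then have "?H' #>\<^bsub>?F'\<^esub> ?h ?s x = ?H' #>\<^bsub>?F'\<^esub> (?h f x \<otimes>\<^bsub>?F'\<^esub> ?h g x)"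
    by (intro H'.repr_independence[symmetric] H'.m_closed H'.is_subgroup) (use closed in auto)
  also have "\<dots> = (?H' #>\<^bsub>?F'\<^esub> ?h f x) <#>\<^bsub>?F'\<^esub> (?H' #>\<^bsub>?F'\<^esub> ?h g x)"
    using H'.rcos_sum[OF closed(2,3)] by simp
  finally show "fmap ?T V V' ?s X = fmap ?T V V' f X \<otimes>\<^bsub>fobj ?T V'\<^esub> fmap ?T V V' g X"
    unfolding x(2) tensor_functor_fmap_coset[OF W V V' s x(1)]
      tensor_functor_fmap_coset[OF W V V' f x(1)] tensor_functor_fmap_coset[OF W V V' g x(1)]
    by (simp add: tensor_functor_def)
qed

section \<open>Exactness of an elementary extension\<close>

lemma elementary_extension_functors:
  assumes "elementary_extension R A B C b a"
  shows "pointed_functor R B" "pointed_functor R (cobj C n)" "pointed_functor R A"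
    "natural_transformation R B (cobj C 1) (b 1)"
    "natural_transformation R (cobj C 1) (cobj C 0) (cdiff C 1)"
    "natural_transformation R (cobj C 0) A (a 0)"
    "surjective_nat R (cobj C 0) A (a 0)"
proof -
  have q: "quasiexact R (shift (single B) 1) C (single A) b a"
    using assms by (simp add: elementary_extension_def)
  have "pointed_functor R (cobj (shift (single B) 1) 1)" "pointed_functor R (cobj (single A) 0)"
    using q by (simp_all only: quasiexact_def chain_complex_def)
  then show "pointed_functor R B" "pointed_functor R A" by (simp_all add: shift_def single_def)
  show "pointed_functor R (cobj C n)"
    using q unfolding quasiexact_def chain_complex_def by blast
  have "natural_transformation R (cobj (shift (single B) 1) 1) (cobj C 1) (b 1)"
    "natural_transformation R (cobj C 0) (cobj (single A) 0) (a 0)"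
    using q unfolding quasiexact_def chain_map_def by blast+
  then show "natural_transformation R B (cobj C 1) (b 1)"
    "natural_transformation R (cobj C 0) A (a 0)" by (simp_all add: shift_def single_def)
  have "natural_transformation R (cobj C 1) (cobj C (1 - 1)) (cdiff C 1)"
    using q unfolding quasiexact_def chain_complex_def by blast
  then show "natural_transformation R (cobj C 1) (cobj C 0) (cdiff C 1)" by simp
  have "surjective_nat R (cobj C 0) (cobj (single A) 0) (a 0)"
    using q unfolding quasiexact_def by blast
  then show "surjective_nat R (cobj C 0) A (a 0)" by (simp add: single_def)
qed

lemma elementary_extension_composites:
  assumes ext: "elementary_extension R A B C b a" and V: "V \<in> proj_modules R"
  shows "z \<in> carrier (fobj B V) \<Longrightarrow> cdiff C 1 V (b 1 V z) = \<one>\<^bsub>fobj (cobj C 0) V\<^esub>"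
    and "x \<in> carrier (fobj (cobj C 1) V) \<Longrightarrow> a 0 V (cdiff C 1 V x) = \<one>\<^bsub>fobj A V\<^esub>"
proof -
  let ?B = "shift (single B) 1"
  have q: "quasiexact R ?B C (single A) b a"
    using ext by (simp add: elementary_extension_def)
  note fs = elementary_extension_functors[OF ext]
  have B: "pointed_functor R (cobj ?B n)" "natural_transformation R (cobj ?B n) (cobj C n) (b n)"
    "natural_transformation R (cobj ?B n) (cobj ?B (n - 1)) (cdiff ?B n)" for n
    using q by (simp_all add: quasiexact_def chain_complex_def chain_map_def)
  {
    assume z: "z \<in> carrier (fobj B V)"
    then have z': "z \<in> carrier (fobj (cobj ?B 1) V)" by (simp add: shift_def single_def)
    interpret b: group_hom "fobj (cobj ?B 0) V" "fobj (cobj C 0) V" "b 0 V"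
      by (rule natural_transformation_group_hom[OF B(1) fs(2) B(2) V])
    have "cdiff ?B 1 V \<in> hom (fobj (cobj ?B 1) V) (fobj (cobj ?B 0) V)"
      using B(3)[of 1] V unfolding natural_transformation_def by simp
    then have "cdiff ?B 1 V z \<in> carrier (fobj (cobj ?B 0) V)" using z' by (rule hom_in_carrier)
    moreover have "carrier (fobj (cobj ?B 0) V) = {\<one>\<^bsub>fobj (cobj ?B 0) V\<^esub>}"
      by (simp add: shift_def single_def zero_functor_def singleton_group_def)
    ultimately have "b 0 V (cdiff ?B 1 V z) = \<one>\<^bsub>fobj (cobj C 0) V\<^esub>" by simp
    moreover have "b (1 - 1) V (cdiff ?B 1 V z) = cdiff C 1 V (b 1 V z)"
      using q V z' unfolding quasiexact_def chain_map_def by blast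
    ultimately show "cdiff C 1 V (b 1 V z) = \<one>\<^bsub>fobj (cobj C 0) V\<^esub>" by simp
  }
  assume x: "x \<in> carrier (fobj (cobj C 1) V)"
  have "a (1 - 1) V (cdiff C 1 V x) = cdiff (single A) 1 V (a 1 V x)"
    using q V x unfolding quasiexact_def chain_map_def by blast
  then show "a 0 V (cdiff C 1 V x) = \<one>\<^bsub>fobj A V\<^esub>" by (simp add: single_def)
qed

text \<open>With all terms outside degrees 0 and 1 zero, acyclicity of \<open>Ker a / Im b\<close> in degree 0 says
  that \<open>Ker a\<close> is the image of the differential, and in degree 1 that the kernel of the differential
  on \<open>C\<^sub>1 / Im b\<close> is zero.\<close>

lemma elementary_extension_exact:
  assumes ext: "elementary_extension R A B C b a" and V: "V \<in> proj_modules R"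
  shows "kernel (fobj (cobj C 1) V) (fobj (cobj C 0) V) (cdiff C 1 V) = b 1 V ` carrier (fobj B V)"
    (is ?exact1)
    and "kernel (fobj (cobj C 0) V) (fobj A V) (a 0 V) = cdiff C 1 V ` carrier (fobj (cobj C 1) V)"
    (is ?exact0)
proof -
  let ?B = "shift (single B) 1" and ?A = "single A"
  let ?K = "ker_mod_im ?B C ?A b a"
  have q: "quasiexact R ?B C ?A b a"
    using ext by (simp add: elementary_extension_def)
  note fs = elementary_extension_functors[OF ext] and comp = elementary_extension_composites[OF ext V]
  have nat: "natural_transformation R (cobj C n) (cobj C (n - 1)) (cdiff C n)" for n
    using q unfolding quasiexact_def chain_complex_def by blast
  have zeroC: "carrier (fobj (cobj C n) V) = {\<one>\<^bsub>fobj (cobj C n) V\<^esub>}" if "n \<noteq> 0" "n \<noteq> 1" for n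
    using ext V that by (simp add: elementary_extension_def zero_on_def)
  have A: "pointed_functor R (cobj ?A n)" "natural_transformation R (cobj C n) (cobj ?A n) (a n)" for n
    using q by (simp_all add: quasiexact_def chain_complex_def chain_map_def)
  have B: "pointed_functor R (cobj ?B n)" "natural_transformation R (cobj ?B n) (cobj C n) (b n)" for n
    using q by (simp_all add: quasiexact_def chain_complex_def chain_map_def)
  let ?im = "\<lambda>n. b n V ` carrier (fobj (cobj ?B n) V)"
  let ?ker = "\<lambda>n. kernel (fobj (cobj C n) V) (fobj (cobj ?A n) V) (a n V)"
  have zeroB: "?im n = {\<one>\<^bsub>fobj (cobj C n) V\<^esub>}" if "n \<noteq> 1" for n
  proof -
    interpret b: group_hom "fobj (cobj ?B n) V" "fobj (cobj C n) V" "b n V"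
      by (rule natural_transformation_group_hom[OF B(1) fs(2) B(2) V])
    have "carrier (fobj (cobj ?B n) V) = {\<one>\<^bsub>fobj (cobj ?B n) V\<^esub>}"
      using that by (simp add: shift_def single_def zero_functor_def singleton_group_def)
    then show ?thesis by simp
  qed
  have imB: "?im 1 = b 1 V ` carrier (fobj B V)" by (simp add: shift_def single_def)
  have one_ker: "\<one>\<^bsub>fobj (cobj C n) V\<^esub> \<in> ?ker n" for n
  proof -
    interpret a: group_hom "fobj (cobj C n) V" "fobj (cobj ?A n) V" "a n V"
      by (rule natural_transformation_group_hom[OF fs(2) A(1) A(2) V])
    show ?thesis by (simp add: kernel_def)
  qed
  have ker1: "?ker 1 = carrier (fobj (cobj C 1) V)"
  proof -
    interpret a: group_hom "fobj (cobj C 1) V" "fobj (cobj ?A 1) V" "a 1 V"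
      by (rule natural_transformation_group_hom[OF fs(2) A(1) A(2) V])
    have "carrier (fobj (cobj ?A 1) V) = {\<one>\<^bsub>fobj (cobj ?A 1) V\<^esub>}"
      by (simp add: single_def zero_functor_def singleton_group_def)
    then show ?thesis using a.hom_closed by (auto simp: kernel_def)
  qed
  have ker0: "?ker 0 = kernel (fobj (cobj C 0) V) (fobj A V) (a 0 V)" by (simp add: single_def)
  have carrier_K: "carrier (fobj (cobj ?K n) V) = (\<lambda>x. ?im n #>\<^bsub>fobj (cobj C n) V\<^esub> x) ` ?ker n" for n
    by (simp add: ker_mod_im_def Let_def carrier_FactGroup r_coset_def)
  have one_K: "\<one>\<^bsub>fobj (cobj ?K n) V\<^esub> = ?im n" for n
    by (simp add: ker_mod_im_def Let_def)
  have diff_K: "cdiff ?K n V X = ?im (n - 1) <#>\<^bsub>fobj (cobj C (n - 1)) V\<^esub> cdiff C n V ` X" for n X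
    by (simp add: ker_mod_im_def Let_def)
  have acyclic: "kernel (fobj (cobj ?K n) V) (fobj (cobj ?K (n - 1)) V) (cdiff ?K n V) =
      cdiff ?K (n + 1) V ` carrier (fobj (cobj ?K (n + 1)) V)" for n
    using q V unfolding quasiexact_def acyclic_complex_def by blast
  interpret G0: comm_group "fobj (cobj C 0) V" by (rule pointed_functor_comm_group[OF fs(2) V])
  interpret G1: comm_group "fobj (cobj C 1) V" by (rule pointed_functor_comm_group[OF fs(2) V])
  interpret b: group_hom "fobj B V" "fobj (cobj C 1) V" "b 1 V"
    by (rule natural_transformation_group_hom[OF fs(1) fs(2) fs(4) V])
  interpret d: group_hom "fobj (cobj C 1) V" "fobj (cobj C 0) V" "cdiff C 1 V"
    by (rule natural_transformation_group_hom[OF fs(2) fs(2) fs(5) V])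
  show ?exact0
  proof (intro equalityI subsetI)
    fix y assume y: "y \<in> kernel (fobj (cobj C 0) V) (fobj A V) (a 0 V)"
    then have yC: "y \<in> carrier (fobj (cobj C 0) V)" by (simp add: kernel_def)
    interpret d0: group_hom "fobj (cobj C 0) V" "fobj (cobj C (0 - 1)) V" "cdiff C 0 V"
      by (rule natural_transformation_group_hom[OF fs(2) fs(2) nat V])
    \<comment> \<open>The image of \<open>b\<close> in degree 0 is trivial, so cosets are singletons there.\<close>
    have "cdiff C 0 V y = \<one>\<^bsub>fobj (cobj C (0 - 1)) V\<^esub>"
      using d0.hom_closed[OF yC] zeroC[of "0 - 1"] by simp
    then have "cdiff ?K 0 V {y} = \<one>\<^bsub>fobj (cobj ?K (0 - 1)) V\<^esub>"
      using zeroB[of "-1"] d0.H.one_closed d0.H.r_one by (simp add: diff_K one_K set_mult_def)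
    moreover have "{y} \<in> carrier (fobj (cobj ?K 0) V)"
      using y yC unfolding carrier_K zeroB[of 0, simplified] ker0
      by (intro image_eqI[of _ _ y]) (simp_all add: r_coset_def)
    ultimately have "{y} \<in> cdiff ?K (0 + 1) V ` carrier (fobj (cobj ?K (0 + 1)) V)"
      unfolding acyclic[of 0, symmetric] by (simp add: kernel_def)
    then obtain X where X: "X \<in> carrier (fobj (cobj ?K 1) V)" "cdiff ?K 1 V X = {y}" by auto
    then obtain x where x: "x \<in> carrier (fobj (cobj C 1) V)" "X = ?im 1 #>\<^bsub>fobj (cobj C 1) V\<^esub> x"
      unfolding carrier_K ker1 by auto
    have "x \<in> X" unfolding x imB
      by (rule subgroup.elemrcos_carrier G1.rcos_self[OF x(1)] b.img_is_subgroup)+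
    then have "cdiff C 1 V x \<in> cdiff ?K 1 V X"
      using x(1) unfolding diff_K by (auto simp: zeroB set_mult_def intro!: bexI)
    then show "y \<in> cdiff C 1 V ` carrier (fobj (cobj C 1) V)" using X x by auto
  qed (use comp in \<open>auto simp: kernel_def\<close>)
  show ?exact1
  proof (intro equalityI subsetI)
    fix x assume "x \<in> kernel (fobj (cobj C 1) V) (fobj (cobj C 0) V) (cdiff C 1 V)"
    then have x: "x \<in> carrier (fobj (cobj C 1) V)" and dx: "cdiff C 1 V x = \<one>\<^bsub>fobj (cobj C 0) V\<^esub>"
      by (simp_all add: kernel_def)
    let ?X = "?im 1 #>\<^bsub>fobj (cobj C 1) V\<^esub> x"
    have "x \<in> ?X" unfolding imB
      by (rule G1.rcos_self[OF x] b.img_is_subgroup)+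
    moreover have "cdiff C 1 V y = \<one>\<^bsub>fobj (cobj C 0) V\<^esub>" if "y \<in> ?X" for y
      using that x dx comp(1) unfolding imB by (auto simp: r_coset_def)
    ultimately have "cdiff C 1 V ` ?X = {\<one>\<^bsub>fobj (cobj C 0) V\<^esub>}" by force
    then have "cdiff ?K 1 V ?X = \<one>\<^bsub>fobj (cobj ?K (1 - 1)) V\<^esub>"
      by (simp add: diff_K one_K zeroB set_mult_def)
    moreover have "?X \<in> carrier (fobj (cobj ?K 1) V)"
      using x unfolding carrier_K ker1 by simp
    ultimately have "?X \<in> cdiff ?K (1 + 1) V ` carrier (fobj (cobj ?K (1 + 1)) V)"
      unfolding acyclic[of 1, symmetric] by (simp add: kernel_def)
    then obtain Y where Y: "Y \<in> carrier (fobj (cobj ?K 2) V)" "cdiff ?K 2 V Y = ?X" by auto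
    interpret d2: group_hom "fobj (cobj C 2) V" "fobj (cobj C (2 - 1)) V" "cdiff C 2 V"
      by (rule natural_transformation_group_hom[OF fs(2) fs(2) nat V])
    have "?ker 2 \<subseteq> {\<one>\<^bsub>fobj (cobj C 2) V\<^esub>}" using zeroC[of 2] by (auto simp: kernel_def)
    then have "Y = {\<one>\<^bsub>fobj (cobj C 2) V\<^esub>}"
      using Y(1) unfolding carrier_K by (auto simp: zeroB r_coset_def)
    then have "cdiff ?K 2 V Y = ?im 1"
      using d2.hom_one b.hom_closed unfolding diff_K by (auto simp: set_mult_def imB)
    then show "x \<in> b 1 V ` carrier (fobj B V)" using \<open>x \<in> ?X\<close> Y imB by simp
  qed (use comp in \<open>auto simp: kernel_def\<close>)
qed

section \<open>The cocycle of an extension\<close>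

context free_triple
begin

text \<open>The Yoneda correspondence for the set-valued functor \<open>V \<mapsto> V\<close>, which is represented by the first
  summand of \<open>P\<close>; the two zeros project \<open>g\<close> to the part of \<open>F(P)\<close> that belongs to it.\<close>

definition yoneda :: "('r, 'v, 'c) ab_functor \<Rightarrow> 'c \<Rightarrow> ('r, 'v) module \<Rightarrow> 'v \<Rightarrow> 'c" where
  "yoneda F g V v = fmap F P V (ev V v \<zero>\<^bsub>V\<^esub> \<zero>\<^bsub>V\<^esub>) g"

lemma natural_family_yoneda:
  assumes F: "pointed_functor R F" and g: "g \<in> carrier (fobj F P)"
    and p: "natural_family R forgetful_functor p"
  shows "natural_family R F (\<lambda>V x y z. yoneda F g V (p V x y z))"
  unfolding yoneda_def
  by (rule natural_family_substitute[OF natural_family_fmap_ev[OF F g],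
        where ?p1.0 = p and ?p2.0 = "\<lambda>V x y z. \<zero>\<^bsub>V\<^esub>" and ?p3.0 = "\<lambda>V x y z. \<zero>\<^bsub>V\<^esub>"])
    (auto intro: p natural_family_zero)

lemma yoneda_closed:
  assumes F: "pointed_functor R F" and g: "g \<in> carrier (fobj F P)"
    and V: "V \<in> proj_modules R" and v: "v \<in> carrier V"
  shows "yoneda F g V v \<in> carrier (fobj F V)"
  using natural_family_closed[OF natural_family_yoneda[OF F g natural_family_coordinates(1)] V v v v] .

lemma fmap_yoneda:
  assumes F: "pointed_functor R F" and g: "g \<in> carrier (fobj F P)"
    and V: "V \<in> proj_modules R" and V': "V' \<in> proj_modules R" and f: "f \<in> linear_maps R V V'"
    and v: "v \<in> carrier V"
  shows "fmap F V V' f (yoneda F g V v) = yoneda F g V' (f v)"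
  using natural_family_fmap[OF natural_family_yoneda[OF F g natural_family_coordinates(1)] V V' f v v v] .

lemma yoneda_zero:
  assumes "pointed_functor R F" "g \<in> carrier (fobj F P)" "V \<in> proj_modules R"
  shows "yoneda F g V \<zero>\<^bsub>V\<^esub> = \<one>\<^bsub>fobj F V\<^esub>"
  unfolding yoneda_def by (rule fmap_ev_zero[OF assms])

lemma natural_transformation_yoneda:
  assumes \<eta>: "natural_transformation R F G \<eta>" and g: "g \<in> carrier (fobj F P)"
    and V: "V \<in> proj_modules R" and v: "v \<in> carrier V"
  shows "\<eta> V (yoneda F g V v) = yoneda G (\<eta> P g) V v"
proof -
  interpret V: left_module R V by (rule proj_modulesD[OF V])
  have "ev V v \<zero>\<^bsub>V\<^esub> \<zero>\<^bsub>V\<^esub> \<in> linear_maps R P V"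
    using v by (intro ev_linear[OF proj_modulesD[OF V]]) auto
  then show ?thesis
    unfolding yoneda_def by (rule natural_transformation_fmap[OF \<eta> P_proj V _ g])
qed

lemma yoneda_forgetful:
  assumes V: "V \<in> proj_modules R" and v: "v \<in> carrier V"
  shows "yoneda forgetful_functor e1 V v = v"
proof -
  interpret V: left_module R V by (rule proj_modulesD[OF V])
  show ?thesis
    using v ev_basis[OF proj_modulesD[OF V] v V.M.zero_closed V.M.zero_closed] by (simp add: yoneda_def)
qed

end

locale additive_extension = free_triple R P e1 e2 e3 ev
  for R :: "('r, 'k) ring_scheme" and P :: "('r, 'v) module" and e1 e2 e3 ev +
  fixes B :: "('r, 'v, 'b) ab_functor" and C :: "('r, 'v, 'c) ab_complex"
    and b :: "int \<Rightarrow> ('r, 'v, 'b, 'c) transformation"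
    and a :: "int \<Rightarrow> ('r, 'v, 'c, 'v) transformation"
  assumes extension: "elementary_extension R forgetful_functor B C b a"
    and additive: "additive_functor R B"
begin

abbreviation "C\<^sub>0 V \<equiv> fobj (cobj C 0) V"
abbreviation "C\<^sub>1 V \<equiv> fobj (cobj C 1) V"
abbreviation "d \<equiv> cdiff C 1"

lemmas functors = elementary_extension_functors[OF extension]
lemmas exact = elementary_extension_exact[OF extension]

lemma C0_group: "V \<in> proj_modules R \<Longrightarrow> comm_group (C\<^sub>0 V)"
  and C1_group: "V \<in> proj_modules R \<Longrightarrow> comm_group (C\<^sub>1 V)"
  by (rule pointed_functor_comm_group[OF functors(2)], assumption)+

lemma d_hom: "V \<in> proj_modules R \<Longrightarrow> group_hom (C\<^sub>1 V) (C\<^sub>0 V) (d V)"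
  by (rule natural_transformation_group_hom[OF functors(2) functors(2) functors(5)])

lemma b_hom: "V \<in> proj_modules R \<Longrightarrow> group_hom (fobj B V) (C\<^sub>1 V) (b 1 V)"
  by (rule natural_transformation_group_hom[OF functors(1) functors(2) functors(4)])

lemma a_hom: "V \<in> proj_modules R \<Longrightarrow> group_hom (C\<^sub>0 V) (fobj forgetful_functor V) (a 0 V)"
  by (rule natural_transformation_group_hom[OF functors(2) functors(3) functors(6)])

lemma d_fmap:
  "\<lbrakk>V \<in> proj_modules R; V' \<in> proj_modules R; f \<in> linear_maps R V V'; x \<in> carrier (C\<^sub>1 V)\<rbrakk> \<Longrightarrow>
   d V' (fmap (cobj C 1) V V' f x) = fmap (cobj C 0) V V' f (d V x)"
  by (rule natural_transformation_fmap[OF functors(5)])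

lemma a_d: "\<lbrakk>V \<in> proj_modules R; x \<in> carrier (C\<^sub>1 V)\<rbrakk> \<Longrightarrow> a 0 V (d V x) = \<zero>\<^bsub>V\<^esub>"
  using elementary_extension_composites(2)[OF extension] by simp

lemma C1_family_eqI:
  assumes \<beta>: "natural_family R (cobj C 1) \<beta>" and \<beta>': "natural_family R (cobj C 1) \<beta>'"
    and eq: "\<And>V x y z. \<lbrakk>V \<in> proj_modules R; x \<in> carrier V; y \<in> carrier V; z \<in> carrier V\<rbrakk> \<Longrightarrow>
      d V (\<beta> V x y z) = d V (\<beta>' V x y z)"
    and eq1: "\<And>V x. \<lbrakk>V \<in> proj_modules R; x \<in> carrier V\<rbrakk> \<Longrightarrow>
      \<beta> V x \<zero>\<^bsub>V\<^esub> \<zero>\<^bsub>V\<^esub> = \<beta>' V x \<zero>\<^bsub>V\<^esub> \<zero>\<^bsub>V\<^esub>"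
    and eq2: "\<And>V y z. \<lbrakk>V \<in> proj_modules R; y \<in> carrier V; z \<in> carrier V\<rbrakk> \<Longrightarrow>
      \<beta> V \<zero>\<^bsub>V\<^esub> y z = \<beta>' V \<zero>\<^bsub>V\<^esub> y z"
    and V: "V \<in> proj_modules R" and v: "x \<in> carrier V" "y \<in> carrier V" "z \<in> carrier V"
  shows "\<beta> V x y z = \<beta>' V x y z"
proof (rule natural_family_eqI[OF functors(1) functors(2) functors(2) additive functors(4) functors(5)
      _ \<beta> \<beta>' eq[OF P_proj e_closed] eq1[OF P_proj e_closed(1)] eq2[OF P_proj e_closed(2,3)] V v])
  show "x \<in> b 1 P ` carrier (fobj B P)" if "x \<in> carrier (C\<^sub>1 P)" "d P x = \<one>\<^bsub>C\<^sub>0 P\<^esub>" for x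
    using that exact(1)[OF P_proj] by (auto simp: kernel_def)
qed

end

text \<open>The element \<open>c\<close> lifts the universal element \<open>e1\<close> of the forgetful functor, so that
  \<open>\<sigma> = yoneda (cobj C 0) c\<close> is a natural section of \<open>a\<close> by maps of pointed sets, and \<open>\<gamma>\<close> lifts to
  \<open>C\<^sub>1\<close> the failure of \<open>\<sigma>\<close> to be additive.\<close>

locale natural_cocycle = additive_extension R P e1 e2 e3 ev B C b a
  for R :: "('r, 'k) ring_scheme" and P :: "('r, 'v) module" and e1 e2 e3 ev
    and B :: "('r, 'v, 'b) ab_functor" and C :: "('r, 'v, 'c) ab_complex" and b a +
  fixes c :: 'c and \<gamma> :: "('r, 'v) module \<Rightarrow> 'v \<Rightarrow> 'v \<Rightarrow> 'c"
  assumes c_closed: "c \<in> carrier (C\<^sub>0 P)" and a_c: "a 0 P c = e1"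
    and \<gamma>_family: "natural_family R (cobj C 1) (\<lambda>V x y z. \<gamma> V x y)"
    and \<gamma>_zero_right: "\<And>V x. \<lbrakk>V \<in> proj_modules R; x \<in> carrier V\<rbrakk> \<Longrightarrow> \<gamma> V x \<zero>\<^bsub>V\<^esub> = \<one>\<^bsub>C\<^sub>1 V\<^esub>"
    and \<gamma>_zero_left: "\<And>V y. \<lbrakk>V \<in> proj_modules R; y \<in> carrier V\<rbrakk> \<Longrightarrow> \<gamma> V \<zero>\<^bsub>V\<^esub> y = \<one>\<^bsub>C\<^sub>1 V\<^esub>"
    and d_\<gamma>: "\<And>V x y. \<lbrakk>V \<in> proj_modules R; x \<in> carrier V; y \<in> carrier V\<rbrakk> \<Longrightarrow>
      d V (\<gamma> V x y) \<otimes>\<^bsub>C\<^sub>0 V\<^esub> yoneda (cobj C 0) c V (x \<oplus>\<^bsub>V\<^esub> y) =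
      yoneda (cobj C 0) c V x \<otimes>\<^bsub>C\<^sub>0 V\<^esub> yoneda (cobj C 0) c V y"

context additive_extension
begin

text \<open>The defect of additivity at the universal pair \<open>(e1, e2)\<close> is killed by \<open>a\<close>, hence lifts along
  \<open>d\<close>; naturality spreads one such lift over all modules.\<close>

lemma exists_defect_lift:
  assumes c: "c \<in> carrier (C\<^sub>0 P)" "a 0 P c = e1"
  obtains \<gamma> where "natural_family R (cobj C 1) (\<lambda>V x y z. \<gamma> V x y)"
    and "\<And>V. V \<in> proj_modules R \<Longrightarrow> \<gamma> V \<zero>\<^bsub>V\<^esub> \<zero>\<^bsub>V\<^esub> = \<one>\<^bsub>C\<^sub>1 V\<^esub>"
    and "\<And>V x y. \<lbrakk>V \<in> proj_modules R; x \<in> carrier V; y \<in> carrier V\<rbrakk> \<Longrightarrow>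
      d V (\<gamma> V x y) \<otimes>\<^bsub>C\<^sub>0 V\<^esub> yoneda (cobj C 0) c V (x \<oplus>\<^bsub>V\<^esub> y) =
      yoneda (cobj C 0) c V x \<otimes>\<^bsub>C\<^sub>0 V\<^esub> yoneda (cobj C 0) c V y"
proof -
  let ?\<sigma> = "yoneda (cobj C 0) c"
  interpret P: left_module R P by (rule proj_modulesD[OF P_proj])
  interpret C0: comm_group "C\<^sub>0 P" by (rule C0_group[OF P_proj])
  interpret a: group_hom "C\<^sub>0 P" "fobj forgetful_functor P" "a 0 P" by (rule a_hom[OF P_proj])
  note \<sigma> = yoneda_closed[OF functors(2) c(1)]
  have a_\<sigma>: "a 0 P (?\<sigma> P v) = v" if "v \<in> carrier P" for v
    using natural_transformation_yoneda[OF functors(6) c(1) P_proj that] yoneda_forgetful[OF P_proj that]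
    by (simp add: c(2))
  have e: "e1 \<in> carrier P" "e2 \<in> carrier P" "e1 \<oplus>\<^bsub>P\<^esub> e2 \<in> carrier P" using e_closed by auto
  have \<sigma>e: "?\<sigma> P e1 \<in> carrier (C\<^sub>0 P)" "?\<sigma> P e2 \<in> carrier (C\<^sub>0 P)" "?\<sigma> P (e1 \<oplus>\<^bsub>P\<^esub> e2) \<in> carrier (C\<^sub>0 P)"
    using e by (auto intro: \<sigma>[OF P_proj])
  define y where "y = ?\<sigma> P e1 \<otimes>\<^bsub>C\<^sub>0 P\<^esub> ?\<sigma> P e2 \<otimes>\<^bsub>C\<^sub>0 P\<^esub> inv\<^bsub>C\<^sub>0 P\<^esub> ?\<sigma> P (e1 \<oplus>\<^bsub>P\<^esub> e2)"
  have y: "y \<in> carrier (C\<^sub>0 P)" using \<sigma>e by (simp add: y_def)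
  have "y \<otimes>\<^bsub>C\<^sub>0 P\<^esub> ?\<sigma> P (e1 \<oplus>\<^bsub>P\<^esub> e2) = ?\<sigma> P e1 \<otimes>\<^bsub>C\<^sub>0 P\<^esub> ?\<sigma> P e2"
    using \<sigma>e by (simp add: y_def C0.m_assoc)
  then have "a 0 P y \<oplus>\<^bsub>P\<^esub> (e1 \<oplus>\<^bsub>P\<^esub> e2) = e1 \<oplus>\<^bsub>P\<^esub> e2"
    using a.hom_mult[OF y \<sigma>e(3)] a.hom_mult[OF \<sigma>e(1,2)] a_\<sigma> e by simp
  then have "a 0 P y = \<zero>\<^bsub>P\<^esub>"
    using e(3) a.hom_closed[OF y] by simp
  then have "y \<in> kernel (C\<^sub>0 P) (fobj forgetful_functor P) (a 0 P)"
    using y by (simp add: kernel_def)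
  then obtain g where g: "g \<in> carrier (C\<^sub>1 P)" "d P g = y"
    unfolding exact(2)[OF P_proj] by auto
  let ?\<gamma> = "\<lambda>V x y. fmap (cobj C 1) P V (ev V x y \<zero>\<^bsub>V\<^esub>) g"
  show thesis
  proof (rule that[of ?\<gamma>])
    show "natural_family R (cobj C 1) (\<lambda>V x y z. ?\<gamma> V x y)"
      by (rule natural_family_substitute[OF natural_family_fmap_ev[OF functors(2) g(1)],
            where ?p1.0 = "\<lambda>V x y z. x" and ?p2.0 = "\<lambda>V x y z. y" and ?p3.0 = "\<lambda>V x y z. \<zero>\<^bsub>V\<^esub>"])
        (auto intro: natural_family_coordinates natural_family_zero)
    show "?\<gamma> V \<zero>\<^bsub>V\<^esub> \<zero>\<^bsub>V\<^esub> = \<one>\<^bsub>C\<^sub>1 V\<^esub>" if "V \<in> proj_modules R" for V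
      by (rule fmap_ev_zero[OF functors(2) g(1) that])
    fix V :: "('r, 'v) module" and v w
    assume V: "V \<in> proj_modules R" and v: "v \<in> carrier V" "w \<in> carrier V"
    interpret V: left_module R V by (rule proj_modulesD[OF V])
    interpret CV: comm_group "C\<^sub>0 V" by (rule C0_group[OF V])
    let ?f = "ev V v w \<zero>\<^bsub>V\<^esub>"
    have f: "?f \<in> linear_maps R P V" using v by (intro ev_linear proj_modulesD[OF V]) auto
    have f_e: "?f e1 = v" "?f e2 = w"
      using ev_basis[OF proj_modulesD[OF V] v V.M.zero_closed] by auto
    interpret f: group_hom "C\<^sub>0 P" "C\<^sub>0 V" "fmap (cobj C 0) P V ?f"
      by (rule pointed_functor_group_hom[OF functors(2) P_proj V f])
    have "d V (?\<gamma> V v w) = ?\<sigma> V v \<otimes>\<^bsub>C\<^sub>0 V\<^esub> ?\<sigma> V w \<otimes>\<^bsub>C\<^sub>0 V\<^esub> inv\<^bsub>C\<^sub>0 V\<^esub> ?\<sigma> V (v \<oplus>\<^bsub>V\<^esub> w)"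
      using d_fmap[OF P_proj V f g(1)] \<sigma>e e
      by (simp add: g(2) y_def fmap_yoneda[OF functors(2) c(1) P_proj V f] f_e linear_maps_add[OF f])
    then show "d V (?\<gamma> V v w) \<otimes>\<^bsub>C\<^sub>0 V\<^esub> ?\<sigma> V (v \<oplus>\<^bsub>V\<^esub> w) = ?\<sigma> V v \<otimes>\<^bsub>C\<^sub>0 V\<^esub> ?\<sigma> V w"
      using \<sigma>[OF V] v by (simp add: CV.m_assoc)
  qed
qed

text \<open>A lift of the defect becomes normalized by subtracting its values on the two axes.  This keeps
  the image under \<open>d\<close>, because the defect itself is normalized.\<close>

lemma exists_natural_cocycle:
  obtains c \<gamma> where "natural_cocycle R P e1 e2 e3 ev B C b a c \<gamma>"
proof -
  have "e1 \<in> a 0 P ` carrier (C\<^sub>0 P)"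
    using functors(7) P_proj e_closed(1) unfolding surjective_nat_def by simp
  then obtain c where c: "c \<in> carrier (C\<^sub>0 P)" "a 0 P c = e1" by auto
  let ?\<sigma> = "yoneda (cobj C 0) c"
  obtain \<gamma>\<^sub>0 where \<gamma>0: "natural_family R (cobj C 1) (\<lambda>V x y z. \<gamma>\<^sub>0 V x y)"
    and \<gamma>0_zero: "\<And>V. V \<in> proj_modules R \<Longrightarrow> \<gamma>\<^sub>0 V \<zero>\<^bsub>V\<^esub> \<zero>\<^bsub>V\<^esub> = \<one>\<^bsub>C\<^sub>1 V\<^esub>"
    and d_\<gamma>0: "\<And>V x y. \<lbrakk>V \<in> proj_modules R; x \<in> carrier V; y \<in> carrier V\<rbrakk> \<Longrightarrow>
      d V (\<gamma>\<^sub>0 V x y) \<otimes>\<^bsub>C\<^sub>0 V\<^esub> ?\<sigma> V (x \<oplus>\<^bsub>V\<^esub> y) = ?\<sigma> V x \<otimes>\<^bsub>C\<^sub>0 V\<^esub> ?\<sigma> V y"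
    using exists_defect_lift[OF c] by blast
  define \<gamma> where "\<gamma> V x y = \<gamma>\<^sub>0 V x y \<otimes>\<^bsub>C\<^sub>1 V\<^esub> inv\<^bsub>C\<^sub>1 V\<^esub> (\<gamma>\<^sub>0 V x \<zero>\<^bsub>V\<^esub> \<otimes>\<^bsub>C\<^sub>1 V\<^esub> \<gamma>\<^sub>0 V \<zero>\<^bsub>V\<^esub> y)" for V x y
  have subst: "natural_family R (cobj C 1) (\<lambda>V x y z. \<gamma>\<^sub>0 V (p V x y z) (q V x y z))"
    if "natural_family R forgetful_functor p" "natural_family R forgetful_functor q" for p q
    by (rule natural_family_substitute[OF \<gamma>0, where ?p1.0 = p and ?p2.0 = q and ?p3.0 = q])
      (use that in auto)
  show thesis
  proof (rule that[of c \<gamma>], unfold_locales)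
    show "natural_family R (cobj C 1) (\<lambda>V x y z. \<gamma> V x y)"
      unfolding \<gamma>_def
      by (intro natural_family_mult natural_family_inverse functors subst
          natural_family_coordinates natural_family_zero)
  next
    fix V :: "('r, 'v) module" and x
    assume V: "V \<in> proj_modules R" and x: "x \<in> carrier V"
    interpret V: left_module R V by (rule proj_modulesD[OF V])
    interpret C1: comm_group "C\<^sub>1 V" by (rule C1_group[OF V])
    show "\<gamma> V x \<zero>\<^bsub>V\<^esub> = \<one>\<^bsub>C\<^sub>1 V\<^esub>" "\<gamma> V \<zero>\<^bsub>V\<^esub> x = \<one>\<^bsub>C\<^sub>1 V\<^esub>"
      using natural_family_closed[OF \<gamma>0 V] x by (simp_all add: \<gamma>_def \<gamma>0_zero V)
    fix y assume y: "y \<in> carrier V"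
    interpret C0: comm_group "C\<^sub>0 V" by (rule C0_group[OF V])
    interpret d: group_hom "C\<^sub>1 V" "C\<^sub>0 V" "d V" by (rule d_hom[OF V])
    note closed = natural_family_closed[OF \<gamma>0 V] yoneda_closed[OF functors(2) c(1) V]
    have "d V (\<gamma>\<^sub>0 V x \<zero>\<^bsub>V\<^esub>) = \<one>\<^bsub>C\<^sub>0 V\<^esub>" "d V (\<gamma>\<^sub>0 V \<zero>\<^bsub>V\<^esub> y) = \<one>\<^bsub>C\<^sub>0 V\<^esub>"
      using d_\<gamma>0[OF V, of x "\<zero>\<^bsub>V\<^esub>"] d_\<gamma>0[OF V, of "\<zero>\<^bsub>V\<^esub>" y] closed x y
      by (simp_all add: yoneda_zero[OF functors(2) c(1) V])
    then have "d V (\<gamma> V x y) = d V (\<gamma>\<^sub>0 V x y)"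
      using closed x y by (simp add: \<gamma>_def)
    then show "d V (\<gamma> V x y) \<otimes>\<^bsub>C\<^sub>0 V\<^esub> ?\<sigma> V (x \<oplus>\<^bsub>V\<^esub> y) = ?\<sigma> V x \<otimes>\<^bsub>C\<^sub>0 V\<^esub> ?\<sigma> V y"
      using d_\<gamma>0[OF V x y] by simp
  qed (use c in auto)
qed

end

context natural_cocycle
begin

abbreviation "\<sigma> \<equiv> yoneda (cobj C 0) c"

lemmas \<sigma>_closed = yoneda_closed[OF functors(2) c_closed]

lemma a_\<sigma>: "\<lbrakk>V \<in> proj_modules R; v \<in> carrier V\<rbrakk> \<Longrightarrow> a 0 V (\<sigma> V v) = v"
  by (simp add: natural_transformation_yoneda[OF functors(6) c_closed] a_c yoneda_forgetful)

lemma \<gamma>_closed: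
  "\<lbrakk>V \<in> proj_modules R; x \<in> carrier V; y \<in> carrier V\<rbrakk> \<Longrightarrow> \<gamma> V x y \<in> carrier (C\<^sub>1 V)"
  using natural_family_closed[OF \<gamma>_family, of V x y x] by simp

lemma natural_family_\<gamma>:
  assumes "natural_family R forgetful_functor p" "natural_family R forgetful_functor q"
  shows "natural_family R (cobj C 1) (\<lambda>V x y z. \<gamma> V (p V x y z) (q V x y z))"
  by (rule natural_family_substitute[OF \<gamma>_family, where ?p1.0 = p and ?p2.0 = q and ?p3.0 = q])
    (use assms in auto)

text \<open>Both sides lift the same defect, as the addition of \<open>V\<close> and that of \<open>C\<^sub>0\<close> commute.\<close>

lemma \<gamma>_commute:
  assumes V: "V \<in> proj_modules R" and v: "x \<in> carrier V" "y \<in> carrier V"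
  shows "\<gamma> V x y = \<gamma> V y x"
proof (rule C1_family_eqI[of "\<lambda>V x y z. \<gamma> V x y" "\<lambda>V x y z. \<gamma> V y x", OF _ _ _ _ _ V v v(1)])
  fix V :: "('r, 'v) module" and x y z
  assume V: "V \<in> proj_modules R" and v: "x \<in> carrier V" "y \<in> carrier V"
  interpret V: left_module R V by (rule proj_modulesD[OF V])
  interpret C0: comm_group "C\<^sub>0 V" by (rule C0_group[OF V])
  interpret d: group_hom "C\<^sub>1 V" "C\<^sub>0 V" "d V" by (rule d_hom[OF V])
  have "d V (\<gamma> V x y) \<otimes>\<^bsub>C\<^sub>0 V\<^esub> \<sigma> V (x \<oplus>\<^bsub>V\<^esub> y) = d V (\<gamma> V y x) \<otimes>\<^bsub>C\<^sub>0 V\<^esub> \<sigma> V (x \<oplus>\<^bsub>V\<^esub> y)"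
    using d_\<gamma>[OF V v] d_\<gamma>[OF V v(2,1)] C0.m_comm \<sigma>_closed[OF V] v by (simp add: V.M.add.m_comm)
  then show "d V (\<gamma> V x y) = d V (\<gamma> V y x)"
    using \<sigma>_closed[OF V] \<gamma>_closed[OF V] v by simp
qed (auto intro: natural_family_\<gamma> natural_family_coordinates simp: \<gamma>_zero_left \<gamma>_zero_right)

text \<open>Under \<open>d\<close> both sides become \<open>\<sigma> x + \<sigma> y + \<sigma> z - \<sigma> (x + y + z)\<close>.\<close>

lemma \<gamma>_cocycle:
  assumes V: "V \<in> proj_modules R" and v: "x \<in> carrier V" "y \<in> carrier V" "z \<in> carrier V"
  shows "\<gamma> V x y \<otimes>\<^bsub>C\<^sub>1 V\<^esub> \<gamma> V (x \<oplus>\<^bsub>V\<^esub> y) z = \<gamma> V y z \<otimes>\<^bsub>C\<^sub>1 V\<^esub> \<gamma> V x (y \<oplus>\<^bsub>V\<^esub> z)"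
proof (rule C1_family_eqI[of "\<lambda>V x y z. \<gamma> V x y \<otimes>\<^bsub>C\<^sub>1 V\<^esub> \<gamma> V (x \<oplus>\<^bsub>V\<^esub> y) z"
      "\<lambda>V x y z. \<gamma> V y z \<otimes>\<^bsub>C\<^sub>1 V\<^esub> \<gamma> V x (y \<oplus>\<^bsub>V\<^esub> z)", OF _ _ _ _ _ V v])
  fix V :: "('r, 'v) module" and x y z
  assume V: "V \<in> proj_modules R" and v: "x \<in> carrier V" "y \<in> carrier V" "z \<in> carrier V"
  interpret V: left_module R V by (rule proj_modulesD[OF V])
  interpret C0: comm_group "C\<^sub>0 V" by (rule C0_group[OF V])
  interpret d: group_hom "C\<^sub>1 V" "C\<^sub>0 V" "d V" by (rule d_hom[OF V])
  have xy: "x \<oplus>\<^bsub>V\<^esub> y \<in> carrier V" and yz: "y \<oplus>\<^bsub>V\<^esub> z \<in> carrier V" using v by auto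
  note closed = \<sigma>_closed[OF V] \<gamma>_closed[OF V]
  let ?s = "\<sigma> V (x \<oplus>\<^bsub>V\<^esub> y \<oplus>\<^bsub>V\<^esub> z)"
  have "d V (\<gamma> V x y \<otimes>\<^bsub>C\<^sub>1 V\<^esub> \<gamma> V (x \<oplus>\<^bsub>V\<^esub> y) z) \<otimes>\<^bsub>C\<^sub>0 V\<^esub> ?s =
      d V (\<gamma> V x y) \<otimes>\<^bsub>C\<^sub>0 V\<^esub> (d V (\<gamma> V (x \<oplus>\<^bsub>V\<^esub> y) z) \<otimes>\<^bsub>C\<^sub>0 V\<^esub> ?s)"
    using closed v by (simp add: C0.m_assoc)
  also have "\<dots> = \<sigma> V x \<otimes>\<^bsub>C\<^sub>0 V\<^esub> (\<sigma> V y \<otimes>\<^bsub>C\<^sub>0 V\<^esub> \<sigma> V z)"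
    using closed v d_\<gamma>[OF V v(1,2)] by (simp add: d_\<gamma>[OF V xy v(3)] C0.m_assoc[symmetric])
  also have "\<dots> = d V (\<gamma> V y z) \<otimes>\<^bsub>C\<^sub>0 V\<^esub> (\<sigma> V x \<otimes>\<^bsub>C\<^sub>0 V\<^esub> \<sigma> V (y \<oplus>\<^bsub>V\<^esub> z))"
    using closed v by (simp add: d_\<gamma>[OF V v(2,3), symmetric] C0.m_lcomm)
  also have "\<dots> = d V (\<gamma> V y z \<otimes>\<^bsub>C\<^sub>1 V\<^esub> \<gamma> V x (y \<oplus>\<^bsub>V\<^esub> z)) \<otimes>\<^bsub>C\<^sub>0 V\<^esub> ?s"
    using closed v by (simp add: d_\<gamma>[OF V v(1) yz, symmetric] C0.m_assoc V.M.a_assoc)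
  finally show "d V (\<gamma> V x y \<otimes>\<^bsub>C\<^sub>1 V\<^esub> \<gamma> V (x \<oplus>\<^bsub>V\<^esub> y) z) = d V (\<gamma> V y z \<otimes>\<^bsub>C\<^sub>1 V\<^esub> \<gamma> V x (y \<oplus>\<^bsub>V\<^esub> z))"
    using closed v by simp
next
  fix V :: "('r, 'v) module" and x y
  assume V: "V \<in> proj_modules R" and v: "x \<in> carrier V" "y \<in> carrier V"
  interpret V: left_module R V by (rule proj_modulesD[OF V])
  interpret C1: comm_group "C\<^sub>1 V" by (rule C1_group[OF V])
  show "\<gamma> V x \<zero>\<^bsub>V\<^esub> \<otimes>\<^bsub>C\<^sub>1 V\<^esub> \<gamma> V (x \<oplus>\<^bsub>V\<^esub> \<zero>\<^bsub>V\<^esub>) \<zero>\<^bsub>V\<^esub> = \<gamma> V \<zero>\<^bsub>V\<^esub> \<zero>\<^bsub>V\<^esub> \<otimes>\<^bsub>C\<^sub>1 V\<^esub> \<gamma> V x (\<zero>\<^bsub>V\<^esub> \<oplus>\<^bsub>V\<^esub> \<zero>\<^bsub>V\<^esub>)"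
    using v by (simp add: \<gamma>_zero_right V)
  show "\<gamma> V \<zero>\<^bsub>V\<^esub> x \<otimes>\<^bsub>C\<^sub>1 V\<^esub> \<gamma> V (\<zero>\<^bsub>V\<^esub> \<oplus>\<^bsub>V\<^esub> x) y = \<gamma> V x y \<otimes>\<^bsub>C\<^sub>1 V\<^esub> \<gamma> V \<zero>\<^bsub>V\<^esub> (x \<oplus>\<^bsub>V\<^esub> y)"
    using v \<gamma>_closed[OF V v] by (simp add: \<gamma>_zero_left V)
qed (intro natural_family_mult natural_family_\<gamma> natural_family_coordinates natural_family_add functors)+

end

section \<open>Existence of a splitting\<close>

context natural_cocycle
begin

text \<open>The extension of \<open>V\<close> by \<open>C\<^sub>1(V)\<close> with factor system \<open>\<gamma>\<close>.  The elements of \<open>V\<close> are renamed by an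
  injection \<open>j\<close>, which lets the values of the functor lie in a prescribed universe.\<close>

definition extension_functor :: "('v \<Rightarrow> 'x) \<Rightarrow> ('r, 'v, 'c \<times> 'x) ab_functor" where
  "extension_functor j =
    \<lparr>fobj = (\<lambda>V. \<lparr>carrier = carrier (C\<^sub>1 V) \<times> j ` carrier V,
       monoid.mult = (\<lambda>(x, p) (y, q).
         (x \<otimes>\<^bsub>C\<^sub>1 V\<^esub> y \<otimes>\<^bsub>C\<^sub>1 V\<^esub> \<gamma> V (the_inv j p) (the_inv j q), j (the_inv j p \<oplus>\<^bsub>V\<^esub> the_inv j q))),
       one = (\<one>\<^bsub>C\<^sub>1 V\<^esub>, j \<zero>\<^bsub>V\<^esub>)\<rparr>),
     fmap = (\<lambda>V V' f (x, p). (fmap (cobj C 1) V V' f x, j (f (the_inv j p))))\<rparr>"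

context
  fixes j :: "'v \<Rightarrow> 'x"
  assumes inj_j: "inj j"
begin

abbreviation "E V \<equiv> fobj (extension_functor j) V"

lemma carrier_extension: "carrier (E V) = carrier (C\<^sub>1 V) \<times> j ` carrier V"
  and mult_extension: "(x, j v) \<otimes>\<^bsub>E V\<^esub> (y, j w) = (x \<otimes>\<^bsub>C\<^sub>1 V\<^esub> y \<otimes>\<^bsub>C\<^sub>1 V\<^esub> \<gamma> V v w, j (v \<oplus>\<^bsub>V\<^esub> w))"
  and one_extension: "\<one>\<^bsub>E V\<^esub> = (\<one>\<^bsub>C\<^sub>1 V\<^esub>, j \<zero>\<^bsub>V\<^esub>)"
  and fmap_extension:
    "fmap (extension_functor j) V V' f (x, j v) = (fmap (cobj C 1) V V' f x, j (f v))"
  by (simp_all add: extension_functor_def the_inv_f_f[OF inj_j])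

lemma extension_elemE:
  assumes "z \<in> carrier (E V)"
  obtains x v where "z = (x, j v)" "x \<in> carrier (C\<^sub>1 V)" "v \<in> carrier V"
  using assms by (auto simp: carrier_extension)

lemma comm_group_extension:
  assumes V: "V \<in> proj_modules R"
  shows "comm_group (E V)"
proof -
  interpret V: left_module R V by (rule proj_modulesD[OF V])
  interpret C1: comm_group "C\<^sub>1 V" by (rule C1_group[OF V])
  note closed = \<gamma>_closed[OF V]
  show ?thesis
  proof (rule comm_groupI)
    fix z z' assume "z \<in> carrier (E V)" "z' \<in> carrier (E V)"
    then obtain x v x' v' where z: "z = (x, j v)" "x \<in> carrier (C\<^sub>1 V)" "v \<in> carrier V"
        "z' = (x', j v')" "x' \<in> carrier (C\<^sub>1 V)" "v' \<in> carrier V"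
      by (metis extension_elemE)
    show "z \<otimes>\<^bsub>E V\<^esub> z' \<in> carrier (E V)"
      using z closed by (simp add: mult_extension carrier_extension)
    show "z \<otimes>\<^bsub>E V\<^esub> z' = z' \<otimes>\<^bsub>E V\<^esub> z"
      using z closed \<gamma>_commute[OF V] by (simp add: mult_extension C1.m_comm V.M.add.m_comm)
    fix z'' assume "z'' \<in> carrier (E V)"
    then obtain x'' v'' where z'': "z'' = (x'', j v'')" "x'' \<in> carrier (C\<^sub>1 V)" "v'' \<in> carrier V"
      by (metis extension_elemE)
    have "x \<otimes>\<^bsub>C\<^sub>1 V\<^esub> x' \<otimes>\<^bsub>C\<^sub>1 V\<^esub> \<gamma> V v v' \<otimes>\<^bsub>C\<^sub>1 V\<^esub> x'' \<otimes>\<^bsub>C\<^sub>1 V\<^esub> \<gamma> V (v \<oplus>\<^bsub>V\<^esub> v') v'' =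
        (x \<otimes>\<^bsub>C\<^sub>1 V\<^esub> x' \<otimes>\<^bsub>C\<^sub>1 V\<^esub> x'') \<otimes>\<^bsub>C\<^sub>1 V\<^esub> (\<gamma> V v v' \<otimes>\<^bsub>C\<^sub>1 V\<^esub> \<gamma> V (v \<oplus>\<^bsub>V\<^esub> v') v'')"
      using z z'' closed by (simp add: C1.m_ac)
    also have "\<dots> = x \<otimes>\<^bsub>C\<^sub>1 V\<^esub> (x' \<otimes>\<^bsub>C\<^sub>1 V\<^esub> x'' \<otimes>\<^bsub>C\<^sub>1 V\<^esub> \<gamma> V v' v'') \<otimes>\<^bsub>C\<^sub>1 V\<^esub> \<gamma> V v (v' \<oplus>\<^bsub>V\<^esub> v'')"
      using z z'' closed by (simp add: C1.m_assoc \<gamma>_cocycle[OF V])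
    finally show "z \<otimes>\<^bsub>E V\<^esub> z' \<otimes>\<^bsub>E V\<^esub> z'' = z \<otimes>\<^bsub>E V\<^esub> (z' \<otimes>\<^bsub>E V\<^esub> z'')"
      using z z'' by (simp add: mult_extension V.M.a_assoc)
  next
    show "\<one>\<^bsub>E V\<^esub> \<in> carrier (E V)" by (simp add: one_extension carrier_extension)
  next
    fix z assume "z \<in> carrier (E V)"
    then obtain x v where z: "z = (x, j v)" "x \<in> carrier (C\<^sub>1 V)" "v \<in> carrier V"
      by (rule extension_elemE)
    show "\<one>\<^bsub>E V\<^esub> \<otimes>\<^bsub>E V\<^esub> z = z"
      using z by (simp add: one_extension mult_extension \<gamma>_zero_left V)
    \<comment> \<open>The inverse lies over \<open>-v\<close>; the factor \<open>\<gamma>(-v, v)\<close> compensates the twist.\<close>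
    let ?z = "(inv\<^bsub>C\<^sub>1 V\<^esub> (x \<otimes>\<^bsub>C\<^sub>1 V\<^esub> \<gamma> V (\<ominus>\<^bsub>V\<^esub> v) v), j (\<ominus>\<^bsub>V\<^esub> v))"
    have "?z \<otimes>\<^bsub>E V\<^esub> z = \<one>\<^bsub>E V\<^esub>"
      using z closed by (simp add: one_extension mult_extension C1.m_assoc V.M.l_neg)
    moreover have "?z \<in> carrier (E V)" using z closed by (simp add: carrier_extension)
    ultimately show "\<exists>z'\<in>carrier (E V). z' \<otimes>\<^bsub>E V\<^esub> z = \<one>\<^bsub>E V\<^esub>" by blast
  qed
qed

lemma pointed_functor_extension: "pointed_functor R (extension_functor j)"
  unfolding pointed_functor_def
proof (intro conjI ballI impI)
  fix V :: "('r, 'v) module" assume V: "V \<in> proj_modules R"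
  interpret V: left_module R V by (rule proj_modulesD[OF V])
  show "comm_group (E V)" by (rule comm_group_extension[OF V])
  show "fmap (extension_functor j) V V (\<lambda>v\<in>carrier V. v) z = z" if "z \<in> carrier (E V)" for z
    using that pointed_functor_id[OF functors(2) V] by (auto simp: fmap_extension elim!: extension_elemE)
  show "carrier (E V) = {\<one>\<^bsub>E V\<^esub>}" if "carrier V = {\<zero>\<^bsub>V\<^esub>}"
    using that V functors(2)[of 1]
    unfolding carrier_extension one_extension pointed_functor_def by auto
  fix V' :: "('r, 'v) module" and f assume V': "V' \<in> proj_modules R" and f: "f \<in> linear_maps R V V'"
  interpret f: group_hom "C\<^sub>1 V" "C\<^sub>1 V'" "fmap (cobj C 1) V V' f"
    by (rule pointed_functor_group_hom[OF functors(2) V V' f])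
  have \<gamma>_fmap: "fmap (cobj C 1) V V' f (\<gamma> V v w) = \<gamma> V' (f v) (f w)"
    if "v \<in> carrier V" "w \<in> carrier V" for v w
    using natural_family_fmap[OF \<gamma>_family V V' f that that(1)] .
  show "fmap (extension_functor j) V V' f \<in> hom (E V) (E V')"
  proof (rule homI)
    fix z z' assume "z \<in> carrier (E V)" "z' \<in> carrier (E V)"
    then obtain x v x' v' where z: "z = (x, j v)" "x \<in> carrier (C\<^sub>1 V)" "v \<in> carrier V"
        "z' = (x', j v')" "x' \<in> carrier (C\<^sub>1 V)" "v' \<in> carrier V"
      by (metis extension_elemE)
    then show "fmap (extension_functor j) V V' f (z \<otimes>\<^bsub>E V\<^esub> z') =
        fmap (extension_functor j) V V' f z \<otimes>\<^bsub>E V'\<^esub> fmap (extension_functor j) V V' f z'"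
      using \<gamma>_closed[OF V]
      by (simp add: mult_extension fmap_extension \<gamma>_fmap linear_maps_add[OF f])
  next
    fix z assume "z \<in> carrier (E V)"
    then obtain x v where z: "z = (x, j v)" "x \<in> carrier (C\<^sub>1 V)" "v \<in> carrier V"
      by (rule extension_elemE)
    then show "fmap (extension_functor j) V V' f z \<in> carrier (E V')"
      by (simp add: fmap_extension carrier_extension linear_maps_closed[OF f])
  qed
  fix V'' :: "('r, 'v) module" and g and z
  assume V'': "V'' \<in> proj_modules R" and g: "g \<in> linear_maps R V' V''" and "z \<in> carrier (E V)"
  then show "fmap (extension_functor j) V V'' (compose (carrier V) g f) z =
      fmap (extension_functor j) V' V'' g (fmap (extension_functor j) V V' f z)"
    using pointed_functor_compose[OF functors(2) V V' V'' f g]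
    by (auto simp: fmap_extension compose_eq elim!: extension_elemE)
qed

text \<open>The map onto \<open>C\<^sub>0\<close> is \<open>(x, v) \<mapsto> d x + \<sigma> v\<close>.  It is additive by the choice of \<open>\<gamma>\<close> and surjective
  because \<open>y - \<sigma> (a y)\<close> lies in \<open>Ker a = Im d\<close>.  Applying \<open>a\<close> to it returns \<open>v\<close>, so its kernel is
  that of \<open>d\<close>.\<close>

lemma splitting_extension:
  "splitting R B C b (extension_functor j) (\<lambda>V x. (x, j \<zero>\<^bsub>V\<^esub>))
     (\<lambda>V (x, p). d V x \<otimes>\<^bsub>C\<^sub>0 V\<^esub> \<sigma> V (the_inv j p))"
  (is "splitting R B C b _ ?c1 ?c0")
proof -
  have c0: "?c0 V (x, j v) = d V x \<otimes>\<^bsub>C\<^sub>0 V\<^esub> \<sigma> V v" for V x v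
    by (simp add: the_inv_f_f[OF inj_j])
  have \<sigma>_zero: "\<sigma> V \<zero>\<^bsub>V\<^esub> = \<one>\<^bsub>C\<^sub>0 V\<^esub>" if "V \<in> proj_modules R" for V
    by (rule yoneda_zero[OF functors(2) c_closed that])
  have c1_nat: "natural_transformation R (cobj C 1) (extension_functor j) ?c1"
    unfolding natural_transformation_def
  proof (intro conjI ballI)
    fix V :: "('r, 'v) module" assume V: "V \<in> proj_modules R"
    interpret V: left_module R V by (rule proj_modulesD[OF V])
    interpret C1: comm_group "C\<^sub>1 V" by (rule C1_group[OF V])
    show "?c1 V \<in> hom (C\<^sub>1 V) (E V)"
      by (rule homI) (simp_all add: carrier_extension mult_extension \<gamma>_zero_left V)
    fix V' :: "('r, 'v) module" and f x
    assume V': "V' \<in> proj_modules R" and f: "f \<in> linear_maps R V V'"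
    show "?c1 V' (fmap (cobj C 1) V V' f x) = fmap (extension_functor j) V V' f (?c1 V x)"
      by (simp add: fmap_extension linear_maps_zero[OF proj_modulesD[OF V] proj_modulesD[OF V'] f])
  qed
  have c0_nat: "natural_transformation R (extension_functor j) (cobj C 0) ?c0"
    unfolding natural_transformation_def
  proof (intro conjI ballI)
    fix V :: "('r, 'v) module" assume V: "V \<in> proj_modules R"
    interpret V: left_module R V by (rule proj_modulesD[OF V])
    interpret C0: comm_group "C\<^sub>0 V" by (rule C0_group[OF V])
    interpret d: group_hom "C\<^sub>1 V" "C\<^sub>0 V" "d V" by (rule d_hom[OF V])
    note closed = \<sigma>_closed[OF V] \<gamma>_closed[OF V]
    show "?c0 V \<in> hom (E V) (C\<^sub>0 V)"
    proof (rule homI)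
      fix z z' assume "z \<in> carrier (E V)" "z' \<in> carrier (E V)"
      then obtain x v x' v' where z: "z = (x, j v)" "x \<in> carrier (C\<^sub>1 V)" "v \<in> carrier V"
          "z' = (x', j v')" "x' \<in> carrier (C\<^sub>1 V)" "v' \<in> carrier V"
        by (metis extension_elemE)
      have "?c0 V (z \<otimes>\<^bsub>E V\<^esub> z') =
          d V x \<otimes>\<^bsub>C\<^sub>0 V\<^esub> d V x' \<otimes>\<^bsub>C\<^sub>0 V\<^esub> (d V (\<gamma> V v v') \<otimes>\<^bsub>C\<^sub>0 V\<^esub> \<sigma> V (v \<oplus>\<^bsub>V\<^esub> v'))"
        using z closed unfolding z mult_extension c0 by (simp add: C0.m_assoc)
      also have "\<dots> = ?c0 V z \<otimes>\<^bsub>C\<^sub>0 V\<^esub> ?c0 V z'"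
        using z closed unfolding z c0 d_\<gamma>[OF V z(3,6)] by (simp add: C0.m_ac)
      finally show "?c0 V (z \<otimes>\<^bsub>E V\<^esub> z') = ?c0 V z \<otimes>\<^bsub>C\<^sub>0 V\<^esub> ?c0 V z'" .
    next
      fix z assume "z \<in> carrier (E V)"
      then obtain x v where z: "z = (x, j v)" "x \<in> carrier (C\<^sub>1 V)" "v \<in> carrier V"
        by (rule extension_elemE)
      then show "?c0 V z \<in> carrier (C\<^sub>0 V)" using closed unfolding z c0 by simp
    qed
    fix V' :: "('r, 'v) module" and f z
    assume V': "V' \<in> proj_modules R" and f: "f \<in> linear_maps R V V'" and "z \<in> carrier (E V)"
    then obtain x v where z: "z = (x, j v)" "x \<in> carrier (C\<^sub>1 V)" "v \<in> carrier V"
      by (meson extension_elemE)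
    interpret f: group_hom "C\<^sub>0 V" "C\<^sub>0 V'" "fmap (cobj C 0) V V' f"
      by (rule pointed_functor_group_hom[OF functors(2) V V' f])
    show "?c0 V' (fmap (extension_functor j) V V' f z) = fmap (cobj C 0) V V' f (?c0 V z)"
      using z closed unfolding z fmap_extension c0
      by (simp add: d_fmap[OF V V' f] fmap_yoneda[OF functors(2) c_closed V V' f])
  qed
  have c1_inj: "injective_nat R (cobj C 1) ?c1"
    by (simp add: injective_nat_def inj_on_def)
  have surj_ker: "?c0 V ` carrier (E V) = carrier (C\<^sub>0 V)"
    "kernel (E V) (C\<^sub>0 V) (?c0 V) = ?c1 V ` b 1 V ` carrier (fobj B V)"
    if V: "V \<in> proj_modules R" for V
  proof -
    interpret V: left_module R V by (rule proj_modulesD[OF V])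
    interpret C0: comm_group "C\<^sub>0 V" by (rule C0_group[OF V])
    interpret d: group_hom "C\<^sub>1 V" "C\<^sub>0 V" "d V" by (rule d_hom[OF V])
    interpret a: group_hom "C\<^sub>0 V" "fobj forgetful_functor V" "a 0 V" by (rule a_hom[OF V])
    interpret b: group_hom "fobj B V" "C\<^sub>1 V" "b 1 V" by (rule b_hom[OF V])
    note closed = \<sigma>_closed[OF V] \<gamma>_closed[OF V]
    have c0_hom: "?c0 V \<in> hom (E V) (C\<^sub>0 V)"
      using c0_nat V by (simp add: natural_transformation_def)
    have "y \<in> ?c0 V ` carrier (E V)" if y: "y \<in> carrier (C\<^sub>0 V)" for y
    proof -
      let ?v = "a 0 V y"
      have v: "?v \<in> carrier V" using a.hom_closed[OF y] by simp
      have "a 0 V (y \<otimes>\<^bsub>C\<^sub>0 V\<^esub> inv\<^bsub>C\<^sub>0 V\<^esub> \<sigma> V ?v) = \<one>\<^bsub>fobj forgetful_functor V\<^esub>"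
        using y v closed a.H.r_inv[of ?v] by (simp add: a_\<sigma>[OF V v] del: a.H.r_inv mult_forgetful)
      then have "y \<otimes>\<^bsub>C\<^sub>0 V\<^esub> inv\<^bsub>C\<^sub>0 V\<^esub> \<sigma> V ?v \<in> d V ` carrier (C\<^sub>1 V)"
        using y v closed unfolding exact(2)[OF V, symmetric] by (simp add: kernel_def)
      then obtain x where x: "x \<in> carrier (C\<^sub>1 V)" "d V x = y \<otimes>\<^bsub>C\<^sub>0 V\<^esub> inv\<^bsub>C\<^sub>0 V\<^esub> \<sigma> V ?v" by auto
      have "?c0 V (x, j ?v) = y" unfolding c0 x(2) using y v closed by (simp add: C0.m_assoc)
      moreover have "(x, j ?v) \<in> carrier (E V)" using x v by (simp add: carrier_extension)
      ultimately show ?thesis by (rule image_eqI[OF sym])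
    qed
    then show "?c0 V ` carrier (E V) = carrier (C\<^sub>0 V)"
      using hom_in_carrier[OF c0_hom] by blast
    show "kernel (E V) (C\<^sub>0 V) (?c0 V) = ?c1 V ` b 1 V ` carrier (fobj B V)"
    proof (intro equalityI subsetI)
      fix z assume "z \<in> kernel (E V) (C\<^sub>0 V) (?c0 V)"
      then have "z \<in> carrier (E V)" and z0: "?c0 V z = \<one>\<^bsub>C\<^sub>0 V\<^esub>" unfolding kernel_def by simp_all
      then obtain x v where z: "z = (x, j v)" "x \<in> carrier (C\<^sub>1 V)" "v \<in> carrier V"
        by (meson extension_elemE)
      have eq: "d V x \<otimes>\<^bsub>C\<^sub>0 V\<^esub> \<sigma> V v = \<one>\<^bsub>C\<^sub>0 V\<^esub>" using z0 unfolding z c0 .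
      have "a 0 V (d V x \<otimes>\<^bsub>C\<^sub>0 V\<^esub> \<sigma> V v) = v"
        using z closed by (simp add: a_d[OF V] a_\<sigma>[OF V])
      then have v: "v = \<zero>\<^bsub>V\<^esub>" unfolding eq using a.hom_one by simp
      then have "d V x = \<one>\<^bsub>C\<^sub>0 V\<^esub>" using eq z by (simp add: \<sigma>_zero[OF V])
      then have "x \<in> b 1 V ` carrier (fobj B V)"
        unfolding exact(1)[OF V, symmetric] using z by (simp add: kernel_def)
      then show "z \<in> ?c1 V ` b 1 V ` carrier (fobj B V)" unfolding z v by blast
    next
      fix z assume "z \<in> ?c1 V ` b 1 V ` carrier (fobj B V)"
      then obtain t where t: "t \<in> carrier (fobj B V)" "z = (b 1 V t, j \<zero>\<^bsub>V\<^esub>)" by auto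
      then have "?c0 V z = \<one>\<^bsub>C\<^sub>0 V\<^esub>"
        unfolding t c0 using elementary_extension_composites(1)[OF extension V t(1)]
        by (simp add: \<sigma>_zero[OF V])
      then show "z \<in> kernel (E V) (C\<^sub>0 V) (?c0 V)"
        using t unfolding kernel_def by (simp add: carrier_extension)
    qed
  qed
  have "?c0 V (?c1 V x) = d V x" if "V \<in> proj_modules R" "x \<in> carrier (C\<^sub>1 V)" for V x
  proof -
    interpret d: group_hom "C\<^sub>1 V" "C\<^sub>0 V" "d V" by (rule d_hom[OF that(1)])
    show ?thesis unfolding c0 using that by (simp add: \<sigma>_zero)
  qed
  then show ?thesis
    unfolding splitting_def surjective_nat_def
    by (intro conjI ballI pointed_functor_extension c1_nat c0_nat c1_inj surj_ker)
qed

end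
end

section \<open>Uniqueness of the splitting\<close>

lemma splittingD:
  assumes "splitting R B C b S s\<^sub>1 s\<^sub>0"
  shows "pointed_functor R S" "natural_transformation R (cobj C 1) S s\<^sub>1"
    "natural_transformation R S (cobj C 0) s\<^sub>0"
    "V \<in> proj_modules R \<Longrightarrow> inj_on (s\<^sub>1 V) (carrier (fobj (cobj C 1) V))"
    "V \<in> proj_modules R \<Longrightarrow> s\<^sub>0 V ` carrier (fobj S V) = carrier (fobj (cobj C 0) V)"
    "\<lbrakk>V \<in> proj_modules R; x \<in> carrier (fobj (cobj C 1) V)\<rbrakk> \<Longrightarrow> s\<^sub>0 V (s\<^sub>1 V x) = cdiff C 1 V x"
    "V \<in> proj_modules R \<Longrightarrow> kernel (fobj S V) (fobj (cobj C 0) V) (s\<^sub>0 V) =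
       s\<^sub>1 V ` b 1 V ` carrier (fobj B V)"
  using assms by (simp_all add: splitting_def injective_nat_def surjective_nat_def)

lemma natural_transformation_compose:
  fixes F :: "('r, 'v, 'c) ab_functor"
  assumes \<eta>: "natural_transformation R F G \<eta>" and \<theta>: "natural_transformation R G H \<theta>"
  shows "natural_transformation R F H (\<lambda>V x. \<theta> V (\<eta> V x))"
  unfolding natural_transformation_def
proof (intro conjI ballI)
  fix V :: "('r, 'v) module" assume V: "V \<in> proj_modules R"
  have \<eta>V: "\<eta> V \<in> hom (fobj F V) (fobj G V)" and \<theta>V: "\<theta> V \<in> hom (fobj G V) (fobj H V)"
    using V assms by (simp_all add: natural_transformation_def)
  show "(\<lambda>x. \<theta> V (\<eta> V x)) \<in> hom (fobj F V) (fobj H V)"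
    using hom_compose[OF \<eta>V \<theta>V] by (simp add: comp_def)
  fix V' :: "('r, 'v) module" and f x
  assume "V' \<in> proj_modules R" "f \<in> linear_maps R V V'" "x \<in> carrier (fobj F V)"
  then show "\<theta> V' (\<eta> V' (fmap F V V' f x)) = fmap H V V' f (\<theta> V (\<eta> V x))"
    using natural_transformation_fmap[OF \<eta> V] natural_transformation_fmap[OF \<theta> V]
      hom_in_carrier[OF \<eta>V] by metis
qed

context natural_cocycle
begin

text \<open>The base point \<open>s\<close> makes \<open>yoneda S s\<close> a natural lift of \<open>\<sigma>\<close> to \<open>S\<close>.\<close>

definition based_splitting ::
    "('r, 'v, 's) ab_functor \<Rightarrow> ('r, 'v, 'c, 's) transformation \<Rightarrow> ('r, 'v, 's, 'c) transformation \<Rightarrow> 's \<Rightarrow> bool"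
  where "based_splitting S s\<^sub>1 s\<^sub>0 s \<longleftrightarrow>
    splitting R B C b S s\<^sub>1 s\<^sub>0 \<and> s \<in> carrier (fobj S P) \<and> s\<^sub>0 P s = c"

lemma exists_based_splitting:
  assumes "splitting R B C b S s\<^sub>1 s\<^sub>0"
  obtains s where "based_splitting S s\<^sub>1 s\<^sub>0 s"
proof -
  have "c \<in> s\<^sub>0 P ` carrier (fobj S P)"
    using splittingD(5)[OF assms P_proj] c_closed by simp
  then show thesis using that assms unfolding based_splitting_def by blast
qed

text \<open>In additive notation \<open>s\<^sub>1 x + yoneda S s v\<close>; the lemmas below show that this identifies \<open>S\<close> with
  the extension given by \<open>\<gamma>\<close>.\<close>

definition glue ::
    "('r, 'v, 's) ab_functor \<Rightarrow> ('r, 'v, 'c, 's) transformation \<Rightarrow> 's \<Rightarrow> ('r, 'v) module \<Rightarrow> 'c \<Rightarrow> 'v \<Rightarrow> 's"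
  where "glue S s\<^sub>1 s V x v = s\<^sub>1 V x \<otimes>\<^bsub>fobj S V\<^esub> yoneda S s V v"

context
  fixes S :: "('r, 'v, 's) ab_functor" and s\<^sub>1 s\<^sub>0 s
  assumes based: "based_splitting S s\<^sub>1 s\<^sub>0 s"
begin

lemmas S_splitting = based[unfolded based_splitting_def, THEN conjunct1]
lemmas S_base = based[unfolded based_splitting_def, THEN conjunct2, THEN conjunct1]
  based[unfolded based_splitting_def, THEN conjunct2, THEN conjunct2]
lemmas S_functor = splittingD(1)[OF S_splitting]

lemma S_group: "V \<in> proj_modules R \<Longrightarrow> comm_group (fobj S V)"
  by (rule pointed_functor_comm_group[OF S_functor])

lemma s1_hom: "V \<in> proj_modules R \<Longrightarrow> group_hom (C\<^sub>1 V) (fobj S V) (s\<^sub>1 V)"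
  by (rule natural_transformation_group_hom[OF functors(2) S_functor splittingD(2)[OF S_splitting]])

lemma s0_hom: "V \<in> proj_modules R \<Longrightarrow> group_hom (fobj S V) (C\<^sub>0 V) (s\<^sub>0 V)"
  by (rule natural_transformation_group_hom[OF S_functor functors(2) splittingD(3)[OF S_splitting]])

lemmas yoneda_S_closed = yoneda_closed[OF S_functor S_base(1)]

lemma s0_yoneda: "\<lbrakk>V \<in> proj_modules R; v \<in> carrier V\<rbrakk> \<Longrightarrow> s\<^sub>0 V (yoneda S s V v) = \<sigma> V v"
  by (simp add: natural_transformation_yoneda[OF splittingD(3)[OF S_splitting] S_base(1)] S_base(2))

lemma glue_closed:
  assumes V: "V \<in> proj_modules R" and "x \<in> carrier (C\<^sub>1 V)" "v \<in> carrier V"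
  shows "glue S s\<^sub>1 s V x v \<in> carrier (fobj S V)"
proof -
  interpret S: comm_group "fobj S V" by (rule S_group[OF V])
  interpret s1: group_hom "C\<^sub>1 V" "fobj S V" "s\<^sub>1 V" by (rule s1_hom[OF V])
  show ?thesis using assms yoneda_S_closed[OF V] by (simp add: glue_def)
qed

lemma s0_glue:
  assumes V: "V \<in> proj_modules R" and "x \<in> carrier (C\<^sub>1 V)" "v \<in> carrier V"
  shows "s\<^sub>0 V (glue S s\<^sub>1 s V x v) = d V x \<otimes>\<^bsub>C\<^sub>0 V\<^esub> \<sigma> V v"
proof -
  interpret s1: group_hom "C\<^sub>1 V" "fobj S V" "s\<^sub>1 V" by (rule s1_hom[OF V])
  interpret s0: group_hom "fobj S V" "C\<^sub>0 V" "s\<^sub>0 V" by (rule s0_hom[OF V])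
  show ?thesis
    using assms yoneda_S_closed[OF V] s0_yoneda[OF V] splittingD(6)[OF S_splitting V]
    by (simp add: glue_def)
qed

lemma glue_zero:
  assumes V: "V \<in> proj_modules R" and "x \<in> carrier (C\<^sub>1 V)"
  shows "glue S s\<^sub>1 s V x \<zero>\<^bsub>V\<^esub> = s\<^sub>1 V x"
proof -
  interpret s1: group_hom "C\<^sub>1 V" "fobj S V" "s\<^sub>1 V" by (rule s1_hom[OF V])
  show ?thesis using assms by (simp add: glue_def yoneda_zero[OF S_functor S_base(1)])
qed

lemma fmap_glue:
  assumes V: "V \<in> proj_modules R" and V': "V' \<in> proj_modules R" and f: "f \<in> linear_maps R V V'"
    and x: "x \<in> carrier (C\<^sub>1 V)" and v: "v \<in> carrier V"
  shows "fmap S V V' f (glue S s\<^sub>1 s V x v) = glue S s\<^sub>1 s V' (fmap (cobj C 1) V V' f x) (f v)"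
proof -
  interpret s1: group_hom "C\<^sub>1 V" "fobj S V" "s\<^sub>1 V" by (rule s1_hom[OF V])
  interpret f: group_hom "fobj S V" "fobj S V'" "fmap S V V' f"
    by (rule pointed_functor_group_hom[OF S_functor V V' f])
  show ?thesis
    using x v yoneda_S_closed[OF V]
    by (simp add: glue_def fmap_yoneda[OF S_functor S_base(1) V V' f]
        natural_transformation_fmap[OF splittingD(2)[OF S_splitting] V V' f])
qed

text \<open>The same \<open>\<gamma>\<close> serves every splitting.  Both sides have the same image under \<open>s\<^sub>0\<close>, whose kernel is
  a copy of the additive functor \<open>B\<close>, and they agree on the axes.\<close>

lemma glue_cocycle:
  assumes V: "V \<in> proj_modules R" and v: "x \<in> carrier V" "y \<in> carrier V"
  shows "glue S s\<^sub>1 s V (\<gamma> V x y) (x \<oplus>\<^bsub>V\<^esub> y) = yoneda S s V x \<otimes>\<^bsub>fobj S V\<^esub> yoneda S s V y"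
proof (rule natural_family_eqI[OF functors(1) S_functor functors(2) additive
      natural_transformation_compose[OF functors(4) splittingD(2)[OF S_splitting]]
      splittingD(3)[OF S_splitting], where
      \<beta> = "\<lambda>V x y z. glue S s\<^sub>1 s V (\<gamma> V x y) (x \<oplus>\<^bsub>V\<^esub> y)" and
      \<beta>' = "\<lambda>V x y z. yoneda S s V x \<otimes>\<^bsub>fobj S V\<^esub> yoneda S s V y", OF _ _ _ _ _ _ V v v(1)])
  interpret P: left_module R P by (rule proj_modulesD[OF P_proj])
  interpret S: comm_group "fobj S P" by (rule S_group[OF P_proj])
  interpret s1: group_hom "C\<^sub>1 P" "fobj S P" "s\<^sub>1 P" by (rule s1_hom[OF P_proj])
  interpret s0: group_hom "fobj S P" "C\<^sub>0 P" "s\<^sub>0 P" by (rule s0_hom[OF P_proj])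
  note closed = yoneda_S_closed[OF P_proj] \<gamma>_closed[OF P_proj] e_closed
  show "x \<in> (\<lambda>z. s\<^sub>1 P (b 1 P z)) ` carrier (fobj B P)"
    if "x \<in> carrier (fobj S P)" "s\<^sub>0 P x = \<one>\<^bsub>C\<^sub>0 P\<^esub>" for x
    using that splittingD(7)[OF S_splitting P_proj] by (auto simp: kernel_def image_image)
  show "natural_family R S (\<lambda>V x y z. yoneda S s V x \<otimes>\<^bsub>fobj S V\<^esub> yoneda S s V y)"
    by (intro natural_family_mult natural_family_yoneda S_functor S_base(1) natural_family_coordinates)
  show "natural_family R S (\<lambda>V x y z. glue S s\<^sub>1 s V (\<gamma> V x y) (x \<oplus>\<^bsub>V\<^esub> y))"
    unfolding natural_family_def
  proof (intro conjI ballI)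
    fix V :: "('r, 'v) module" and x y
    assume V: "V \<in> proj_modules R" and v: "x \<in> carrier V" "y \<in> carrier V"
    interpret V: left_module R V by (rule proj_modulesD[OF V])
    show "glue S s\<^sub>1 s V (\<gamma> V x y) (x \<oplus>\<^bsub>V\<^esub> y) \<in> carrier (fobj S V)"
      using v \<gamma>_closed[OF V] by (simp add: glue_closed V)
    fix V' :: "('r, 'v) module" and f assume V': "V' \<in> proj_modules R" and f: "f \<in> linear_maps R V V'"
    show "fmap S V V' f (glue S s\<^sub>1 s V (\<gamma> V x y) (x \<oplus>\<^bsub>V\<^esub> y)) =
        glue S s\<^sub>1 s V' (\<gamma> V' (f x) (f y)) (f x \<oplus>\<^bsub>V'\<^esub> f y)"
      using v \<gamma>_closed[OF V] natural_family_fmap[OF \<gamma>_family V V' f v v(1)]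
      by (simp add: fmap_glue V V' f linear_maps_add[OF f])
  qed
  show "s\<^sub>0 P (glue S s\<^sub>1 s P (\<gamma> P e1 e2) (e1 \<oplus>\<^bsub>P\<^esub> e2)) =
      s\<^sub>0 P (yoneda S s P e1 \<otimes>\<^bsub>fobj S P\<^esub> yoneda S s P e2)"
    using closed by (simp add: s0_glue[OF P_proj] d_\<gamma>[OF P_proj] s0_yoneda[OF P_proj])
  show "glue S s\<^sub>1 s P (\<gamma> P e1 \<zero>\<^bsub>P\<^esub>) (e1 \<oplus>\<^bsub>P\<^esub> \<zero>\<^bsub>P\<^esub>) =
      yoneda S s P e1 \<otimes>\<^bsub>fobj S P\<^esub> yoneda S s P \<zero>\<^bsub>P\<^esub>"
    using closed
    by (simp add: glue_def \<gamma>_zero_right[OF P_proj] yoneda_zero[OF S_functor S_base(1) P_proj])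
  show "glue S s\<^sub>1 s P (\<gamma> P \<zero>\<^bsub>P\<^esub> e2) (\<zero>\<^bsub>P\<^esub> \<oplus>\<^bsub>P\<^esub> e2) =
      yoneda S s P \<zero>\<^bsub>P\<^esub> \<otimes>\<^bsub>fobj S P\<^esub> yoneda S s P e2"
    using closed
    by (simp add: glue_def \<gamma>_zero_left[OF P_proj] yoneda_zero[OF S_functor S_base(1) P_proj])
qed

lemma glue_mult:
  assumes V: "V \<in> proj_modules R" and x: "x \<in> carrier (C\<^sub>1 V)" "x' \<in> carrier (C\<^sub>1 V)"
    and v: "v \<in> carrier V" "v' \<in> carrier V"
  shows "glue S s\<^sub>1 s V x v \<otimes>\<^bsub>fobj S V\<^esub> glue S s\<^sub>1 s V x' v' =
    glue S s\<^sub>1 s V (x \<otimes>\<^bsub>C\<^sub>1 V\<^esub> x' \<otimes>\<^bsub>C\<^sub>1 V\<^esub> \<gamma> V v v') (v \<oplus>\<^bsub>V\<^esub> v')"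
proof -
  interpret V: left_module R V by (rule proj_modulesD[OF V])
  interpret S: comm_group "fobj S V" by (rule S_group[OF V])
  interpret s1: group_hom "C\<^sub>1 V" "fobj S V" "s\<^sub>1 V" by (rule s1_hom[OF V])
  note closed = yoneda_S_closed[OF V] \<gamma>_closed[OF V]
  have "glue S s\<^sub>1 s V x v \<otimes>\<^bsub>fobj S V\<^esub> glue S s\<^sub>1 s V x' v' =
      s\<^sub>1 V x \<otimes>\<^bsub>fobj S V\<^esub> s\<^sub>1 V x' \<otimes>\<^bsub>fobj S V\<^esub> (yoneda S s V v \<otimes>\<^bsub>fobj S V\<^esub> yoneda S s V v')"
    using x v closed by (simp add: glue_def S.m_ac)
  then show ?thesis
    unfolding glue_cocycle[OF V v, symmetric] using x v closed by (simp add: glue_def S.m_assoc)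
qed

lemma glue_inject:
  assumes V: "V \<in> proj_modules R" and x: "x \<in> carrier (C\<^sub>1 V)" "x' \<in> carrier (C\<^sub>1 V)"
    and v: "v \<in> carrier V" "v' \<in> carrier V" and eq: "glue S s\<^sub>1 s V x v = glue S s\<^sub>1 s V x' v'"
  shows "x = x' \<and> v = v'"
proof -
  interpret V: left_module R V by (rule proj_modulesD[OF V])
  interpret S: comm_group "fobj S V" by (rule S_group[OF V])
  interpret s1: group_hom "C\<^sub>1 V" "fobj S V" "s\<^sub>1 V" by (rule s1_hom[OF V])
  interpret d: group_hom "C\<^sub>1 V" "C\<^sub>0 V" "d V" by (rule d_hom[OF V])
  interpret a: group_hom "C\<^sub>0 V" "fobj forgetful_functor V" "a 0 V" by (rule a_hom[OF V])
  have "a 0 V (s\<^sub>0 V (glue S s\<^sub>1 s V y w)) = w" if "y \<in> carrier (C\<^sub>1 V)" "w \<in> carrier V" for y w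
    using that \<sigma>_closed[OF V] by (simp add: s0_glue[OF V] a_d[OF V] a_\<sigma>[OF V])
  then have vv: "v = v'" using eq x v by metis
  then have "s\<^sub>1 V x = s\<^sub>1 V x'"
    using eq x v yoneda_S_closed[OF V] by (simp add: glue_def)
  then show ?thesis using inj_onD[OF splittingD(4)[OF S_splitting V]] x vv by blast
qed

text \<open>For \<open>v = a (s\<^sub>0 z)\<close>, the element \<open>s\<^sub>0 (z - yoneda S s v)\<close> of \<open>Ker a\<close> has the form \<open>d y\<close>, and
  \<open>z - yoneda S s v - s\<^sub>1 y\<close> lies in \<open>Ker s\<^sub>0\<close>, which is contained in the image of \<open>s\<^sub>1\<close>.\<close>

lemma glue_surj:
  assumes V: "V \<in> proj_modules R" and z: "z \<in> carrier (fobj S V)"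
  obtains x v where "x \<in> carrier (C\<^sub>1 V)" "v \<in> carrier V" "z = glue S s\<^sub>1 s V x v"
proof -
  interpret V: left_module R V by (rule proj_modulesD[OF V])
  interpret S: comm_group "fobj S V" by (rule S_group[OF V])
  interpret s1: group_hom "C\<^sub>1 V" "fobj S V" "s\<^sub>1 V" by (rule s1_hom[OF V])
  interpret s0: group_hom "fobj S V" "C\<^sub>0 V" "s\<^sub>0 V" by (rule s0_hom[OF V])
  interpret C0: comm_group "C\<^sub>0 V" by (rule C0_group[OF V])
  interpret C1: comm_group "C\<^sub>1 V" by (rule C1_group[OF V])
  interpret a: group_hom "C\<^sub>0 V" "fobj forgetful_functor V" "a 0 V" by (rule a_hom[OF V])
  interpret b: group_hom "fobj B V" "C\<^sub>1 V" "b 1 V" by (rule b_hom[OF V])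
  define v where "v = a 0 V (s\<^sub>0 V z)"
  have v: "v \<in> carrier V" using a.hom_closed[OF s0.hom_closed[OF z]] by (simp add: v_def)
  note closed = yoneda_S_closed[OF V v] \<sigma>_closed[OF V v]
  define w where "w = z \<otimes>\<^bsub>fobj S V\<^esub> inv\<^bsub>fobj S V\<^esub> yoneda S s V v"
  have w: "w \<in> carrier (fobj S V)" using z closed by (simp add: w_def)
  have "a 0 V (s\<^sub>0 V w) = \<one>\<^bsub>fobj forgetful_functor V\<^esub>"
    using z closed a.H.r_inv[of v] v
    by (simp add: w_def s0_yoneda[OF V v] a_\<sigma>[OF V v] v_def[symmetric] del: a.H.r_inv mult_forgetful)
  then have "s\<^sub>0 V w \<in> d V ` carrier (C\<^sub>1 V)"
    unfolding exact(2)[OF V, symmetric] using w by (simp add: kernel_def)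
  then obtain y where y: "y \<in> carrier (C\<^sub>1 V)" "s\<^sub>0 V w = d V y" by auto
  have "w \<otimes>\<^bsub>fobj S V\<^esub> inv\<^bsub>fobj S V\<^esub> s\<^sub>1 V y \<in> s\<^sub>1 V ` b 1 V ` carrier (fobj B V)"
    unfolding splittingD(7)[OF S_splitting V, symmetric] kernel_def
    using w y s0.H.r_inv[OF s0.hom_closed[OF w]] by (simp add: splittingD(6)[OF S_splitting V])
  then obtain t where t: "t \<in> carrier (fobj B V)"
      "w \<otimes>\<^bsub>fobj S V\<^esub> inv\<^bsub>fobj S V\<^esub> s\<^sub>1 V y = s\<^sub>1 V (b 1 V t)" by auto
  have "w = s\<^sub>1 V (b 1 V t) \<otimes>\<^bsub>fobj S V\<^esub> s\<^sub>1 V y"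
    unfolding t(2)[symmetric] using w y by (simp add: S.m_assoc)
  then have "w = s\<^sub>1 V (b 1 V t \<otimes>\<^bsub>C\<^sub>1 V\<^esub> y)" using t y by simp
  moreover have "z = w \<otimes>\<^bsub>fobj S V\<^esub> yoneda S s V v"
    using z closed by (simp add: w_def S.m_assoc)
  ultimately have "z = glue S s\<^sub>1 s V (b 1 V t \<otimes>\<^bsub>C\<^sub>1 V\<^esub> y) v" by (simp add: glue_def)
  then show thesis by (intro that[OF _ v]) (use t y in auto)
qed

end

text \<open>The coordinates \<open>(x, v)\<close> of an element of \<open>S\<close> are read off and reinterpreted in \<open>T\<close>.\<close>

definition comparison where
  "comparison S s\<^sub>1 s T t\<^sub>1 t V z = (SOME w. \<exists>x\<in>carrier (C\<^sub>1 V). \<exists>v\<in>carrier V.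
     z = glue S s\<^sub>1 s V x v \<and> w = glue T t\<^sub>1 t V x v)"

lemma comparison_glue:
  assumes S: "based_splitting S s\<^sub>1 s\<^sub>0 s" and V: "V \<in> proj_modules R"
    and x: "x \<in> carrier (C\<^sub>1 V)" and v: "v \<in> carrier V"
  shows "comparison S s\<^sub>1 s T t\<^sub>1 t V (glue S s\<^sub>1 s V x v) = glue T t\<^sub>1 t V x v"
  unfolding comparison_def
proof (rule some_equality)
  show "\<exists>x'\<in>carrier (C\<^sub>1 V). \<exists>v'\<in>carrier V. glue S s\<^sub>1 s V x v = glue S s\<^sub>1 s V x' v' \<and>
      glue T t\<^sub>1 t V x v = glue T t\<^sub>1 t V x' v'" using x v by blast
qed (use glue_inject[OF S V] x v in blast)

lemma splitting_map_comparison: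
  fixes S :: "('r, 'v, 's) ab_functor" and T :: "('r, 'v, 't) ab_functor"
  assumes S: "based_splitting S s\<^sub>1 s\<^sub>0 s" and T: "based_splitting T t\<^sub>1 t\<^sub>0 t"
  shows "splitting_map R C S s\<^sub>1 s\<^sub>0 T t\<^sub>1 t\<^sub>0 (comparison S s\<^sub>1 s T t\<^sub>1 t)" (is "splitting_map _ _ _ _ _ _ _ _ ?\<theta>")
  unfolding splitting_map_def natural_transformation_def
proof (intro conjI ballI)
  fix V :: "('r, 'v) module" assume V: "V \<in> proj_modules R"
  interpret V: left_module R V by (rule proj_modulesD[OF V])
  interpret C1: comm_group "C\<^sub>1 V" by (rule C1_group[OF V])
  show "?\<theta> V \<in> hom (fobj S V) (fobj T V)"
  proof (rule homI)
    fix z z' assume "z \<in> carrier (fobj S V)" "z' \<in> carrier (fobj S V)"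
    then obtain x v x' v' where z: "x \<in> carrier (C\<^sub>1 V)" "v \<in> carrier V" "z = glue S s\<^sub>1 s V x v"
        "x' \<in> carrier (C\<^sub>1 V)" "v' \<in> carrier V" "z' = glue S s\<^sub>1 s V x' v'"
      by (metis glue_surj[OF S V])
    show "?\<theta> V z \<in> carrier (fobj T V)"
      using z by (simp add: comparison_glue[OF S V] glue_closed[OF T V])
    show "?\<theta> V (z \<otimes>\<^bsub>fobj S V\<^esub> z') = ?\<theta> V z \<otimes>\<^bsub>fobj T V\<^esub> ?\<theta> V z'"
      using z \<gamma>_closed[OF V]
      by (simp add: glue_mult[OF S V] glue_mult[OF T V] comparison_glue[OF S V])
  qed
  show "?\<theta> V (s\<^sub>1 V x) = t\<^sub>1 V x" if "x \<in> carrier (C\<^sub>1 V)" for x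
    using comparison_glue[OF S V that V.M.zero_closed, of T t\<^sub>1 t]
    by (simp add: glue_zero[OF S V that] glue_zero[OF T V that])
  fix z assume "z \<in> carrier (fobj S V)"
  then obtain x v where z: "x \<in> carrier (C\<^sub>1 V)" "v \<in> carrier V" "z = glue S s\<^sub>1 s V x v"
    by (metis glue_surj[OF S V])
  show "t\<^sub>0 V (?\<theta> V z) = s\<^sub>0 V z"
    using z by (simp add: comparison_glue[OF S V] s0_glue[OF S V] s0_glue[OF T V])
  fix V' :: "('r, 'v) module" and f assume V': "V' \<in> proj_modules R" and f: "f \<in> linear_maps R V V'"
  interpret f: group_hom "C\<^sub>1 V" "C\<^sub>1 V'" "fmap (cobj C 1) V V' f"
    by (rule pointed_functor_group_hom[OF functors(2) V V' f])
  show "?\<theta> V' (fmap S V V' f z) = fmap T V V' f (?\<theta> V z)"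
    using z by (simp add: comparison_glue[OF S V] comparison_glue[OF S V'] fmap_glue[OF S V V' f]
        fmap_glue[OF T V V' f] linear_maps_closed[OF f])
qed

lemma splittings_isomorphic:
  assumes "splitting R B C b S s\<^sub>1 s\<^sub>0" and "splitting R B C b T t\<^sub>1 t\<^sub>0"
  shows "isomorphic_splittings R C S s\<^sub>1 s\<^sub>0 T t\<^sub>1 t\<^sub>0"
proof -
  obtain s t where S: "based_splitting S s\<^sub>1 s\<^sub>0 s" and T: "based_splitting T t\<^sub>1 t\<^sub>0 t"
    using exists_based_splitting assms by metis
  have "comparison T t\<^sub>1 t S s\<^sub>1 s V (comparison S s\<^sub>1 s T t\<^sub>1 t V z) = z"
    if "V \<in> proj_modules R" "z \<in> carrier (fobj S V)" for V z
    by (rule glue_surj[OF S that]) (simp add: comparison_glue[OF S that(1)] comparison_glue[OF T that(1)])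
  moreover have "comparison S s\<^sub>1 s T t\<^sub>1 t V (comparison T t\<^sub>1 t S s\<^sub>1 s V z) = z"
    if "V \<in> proj_modules R" "z \<in> carrier (fobj T V)" for V z
    by (rule glue_surj[OF T that]) (simp add: comparison_glue[OF S that(1)] comparison_glue[OF T that(1)])
  ultimately show ?thesis
    unfolding isomorphic_splittings_def
    using splitting_map_comparison[OF S T] splitting_map_comparison[OF T S] by blast
qed

end

section \<open>Existence and uniqueness\<close>

(* The universe 'v of the left modules has to contain a copy of every finitely generated module.
   A splitting is found with values in the universe 'c * (tensor product carrier); it is unique
   among splittings with values in arbitrary universes 's and 't. *)

theorem proposition3p4:
  fixes R :: "('r, 'k) ring_scheme" and W :: "('r, 'w) module"
    and u :: "'r list \<Rightarrow> 'v"
    and C :: "('r, 'v, 'c) ab_complex"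
    and b :: "int \<Rightarrow> ('r, 'v, ('w \<times> 'v \<Rightarrow>\<^sub>0 int) set, 'c) transformation"
    and a :: "int \<Rightarrow> ('r, 'v, 'c, 'v) transformation"
  assumes "ring R" and "right_module R W" and "inj u"
    and "elementary_extension R forgetful_functor (tensor_functor R W) C b a"
  shows "(\<exists>(C\<^sub>0\<^sub>1 :: ('r, 'v, 'c \<times> ('w \<times> 'v \<Rightarrow>\<^sub>0 int) set) ab_functor) c\<^sub>1 c\<^sub>0.
            splitting R (tensor_functor R W) C b C\<^sub>0\<^sub>1 c\<^sub>1 c\<^sub>0) \<and>
         (\<forall>(S :: ('r, 'v, 's) ab_functor) s\<^sub>1 s\<^sub>0 (T :: ('r, 'v, 't) ab_functor) t\<^sub>1 t\<^sub>0.
            splitting R (tensor_functor R W) C b S s\<^sub>1 s\<^sub>0 \<longrightarrow>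
            splitting R (tensor_functor R W) C b T t\<^sub>1 t\<^sub>0 \<longrightarrow>
            isomorphic_splittings R C S s\<^sub>1 s\<^sub>0 T t\<^sub>1 t\<^sub>0)"
proof -
  obtain P e1 e2 e3 and ev :: "('r, 'v) module \<Rightarrow> 'v \<Rightarrow> 'v \<Rightarrow> 'v \<Rightarrow> 'v \<Rightarrow> 'v"
    where "free_triple R P e1 e2 e3 ev"
    using exists_free_triple[OF assms(1,3)] .
  then interpret additive_extension R P e1 e2 e3 ev "tensor_functor R W" C b a
    by (intro additive_extension.intro additive_extension_axioms.intro assms(4)
        additive_tensor_functor[OF assms(2)])
  obtain c \<gamma> where "natural_cocycle R P e1 e2 e3 ev (tensor_functor R W) C b a c \<gamma>"
    by (rule exists_natural_cocycle)
  then interpret natural_cocycle R P e1 e2 e3 ev "tensor_functor R W" C b a c \<gamma> .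
  \<comment> \<open>Any injection of \<open>'v\<close> into the universe of the tensor products serves to rename \<open>V\<close>.\<close>
  have "inj (\<lambda>v :: 'v. {frag_of (undefined :: 'w, v)})"
    by (simp add: inj_on_def frag_of_eq)
  from splitting_extension[OF this] show ?thesis
    using splittings_isomorphic by blast
qed

end
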